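(* Let $p$ be a prime, $n\ge 1$ an integer, $C_{p^n}=\langle g\rangle$ the cyclic group of order $p^n$, and $\theta$ a primitive $p^n$-th root of unity. Let $\pi_1:\mathbb{Z}C_{p^n}\to\mathbb{Z}[\theta]$ be the ring homomorphism with $\pi_1(g)=\theta$, and let $\overline{\pi}_1:\mathcal{U}_1(\mathbb{Z}C_{p^n})\to\mathcal{U}(\mathbb{Z}[\theta])$ be the group homomorphism obtained by restricting $\pi_1$. Then, as groups, $$\mathcal{U}_1(\mathbb{Z}C_{p^n})\cong \ker(\overline{\pi}_1)\times \mathrm{Im}(\overline{\pi}_1).$$
   Context: $\mathcal{U}(R)$ denotes the group of units of a ring $R$. $\mathcal{U}_1(\mathbb{Z}G)$ denotes the group of normalized units of the integral group ring $\mathbb{Z}G$, i.e. units $\sum a_x x$ with augmentation $\sum a_x=1$. *)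

theory Defs
  imports
    Complex_Main
    "HOL-Library.Poly_Mapping"
    "HOL-Computational_Algebra.Primes"
    "HOL-Algebra.Algebra"
    "HOL-Algebra.Algebraic_Closure_Type"
begin

text \<open>
  The integral group ring is carried by the finitely supported integer-valued functions with
  support in the group; its additive structure is that of \<^const>\<open>free_Abelian_group\<close>, and
  \<^const>\<open>frag_of\<close> embeds the group.
\<close>

definition integral_group_ring :: "('a, 'm) monoid_scheme \<Rightarrow> ('a \<Rightarrow>\<^sub>0 int) ring"
  where "integral_group_ring G =
    \<lparr>carrier = {a. Poly_Mapping.keys a \<subseteq> carrier G},
     monoid.mult = (\<lambda>a b. \<Sum>x\<in>Poly_Mapping.keys a. \<Sum>y\<in>Poly_Mapping.keys b.
       Poly_Mapping.single (x \<otimes>\<^bsub>G\<^esub> y) (Poly_Mapping.lookup a x * Poly_Mapping.lookup b y)),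
     one = Poly_Mapping.single \<one>\<^bsub>G\<^esub> 1,
     ring.zero = 0,
     add = (+)\<rparr>"

definition augmentation :: "('a \<Rightarrow>\<^sub>0 int) \<Rightarrow> int"
  where "augmentation a = (\<Sum>x\<in>Poly_Mapping.keys a. Poly_Mapping.lookup a x)"

definition normalized_units :: "('a, 'm) monoid_scheme \<Rightarrow> ('a \<Rightarrow>\<^sub>0 int) monoid"
  where "normalized_units G =
    (units_of (integral_group_ring G))
      \<lparr>carrier := {u \<in> Units (integral_group_ring G). augmentation u = 1}\<rparr>"

definition primitive_root_of_unity :: "nat \<Rightarrow> complex \<Rightarrow> bool"
  where "primitive_root_of_unity m \<theta> \<longleftrightarrow>
    m > 0 \<and> \<theta> ^ m = 1 \<and> (\<forall>k. 0 < k \<and> k < m \<longrightarrow> \<theta> ^ k \<noteq> 1)"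

definition int_adjoin :: "complex \<Rightarrow> complex ring"
  where "int_adjoin \<theta> =
    ring_of_type_algebra\<lparr>carrier := generate_ring ring_of_type_algebra {\<theta>}\<rparr>"

lemma integral_group_ring_mult:
  "a \<otimes>\<^bsub>integral_group_ring G\<^esub> b = frag_extend (\<lambda>x. frag_extend (\<lambda>y. frag_of (x \<otimes>\<^bsub>G\<^esub> y)) b) a"
proof -
  have s: "frag_cmul c (Poly_Mapping.single z d) = Poly_Mapping.single z (c * d)" for c d and z :: 'a
    by (rule poly_mapping_eqI) (auto simp: lookup_single when_def)
  show ?thesis
    by (simp add: integral_group_ring_def frag_extend_def frag_cmul_sum s)
qed

lemma integral_group_ring_mult_add:
  "(a + b) \<otimes>\<^bsub>integral_group_ring G\<^esub> c = a \<otimes>\<^bsub>integral_group_ring G\<^esub> c + b \<otimes>\<^bsub>integral_group_ring G\<^esub> c"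
  "c \<otimes>\<^bsub>integral_group_ring G\<^esub> (a + b) = c \<otimes>\<^bsub>integral_group_ring G\<^esub> a + c \<otimes>\<^bsub>integral_group_ring G\<^esub> b"
proof -
  have add: "frag_extend (\<lambda>x. f x + h x) c = frag_extend f c + frag_extend h c" for f h :: "'a \<Rightarrow> 'a \<Rightarrow>\<^sub>0 int"
    by (simp add: frag_extend_def frag_cmul_distrib2 sum.distrib)
  show "(a + b) \<otimes>\<^bsub>integral_group_ring G\<^esub> c = a \<otimes>\<^bsub>integral_group_ring G\<^esub> c + b \<otimes>\<^bsub>integral_group_ring G\<^esub> c"
    "c \<otimes>\<^bsub>integral_group_ring G\<^esub> (a + b) = c \<otimes>\<^bsub>integral_group_ring G\<^esub> a + c \<otimes>\<^bsub>integral_group_ring G\<^esub> b"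
    by (simp_all add: integral_group_ring_mult frag_extend_add add)
qed

lemma integral_group_ring_mult_diff:
  "(a - b) \<otimes>\<^bsub>integral_group_ring G\<^esub> c = a \<otimes>\<^bsub>integral_group_ring G\<^esub> c - b \<otimes>\<^bsub>integral_group_ring G\<^esub> c"
  "c \<otimes>\<^bsub>integral_group_ring G\<^esub> (a - b) = c \<otimes>\<^bsub>integral_group_ring G\<^esub> a - c \<otimes>\<^bsub>integral_group_ring G\<^esub> b"
  by (simp_all add: eq_diff_eq flip: integral_group_ring_mult_add)

lemma ring_int_adjoin: "ring (int_adjoin \<theta>)"
  unfolding int_adjoin_def
  by (rule ring.generate_ring_is_ring[OF ring_from_type_algebra])
     (simp add: ring_of_type_algebra_def)

lemma ring_integral_group_ring:
  assumes "group G"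
  shows "ring (integral_group_ring G)"
proof -
  interpret G: group G by fact
  let ?R = "integral_group_ring G"
  have car: "carrier ?R = {a. Poly_Mapping.keys a \<subseteq> carrier G}"
    and ad: "\<And>a b. a \<oplus>\<^bsub>?R\<^esub> b = a + b" and ze: "\<zero>\<^bsub>?R\<^esub> = 0" and on: "\<one>\<^bsub>?R\<^esub> = frag_of \<one>\<^bsub>G\<^esub>"
    by (simp_all add: integral_group_ring_def)
  note mu = integral_group_ring_mult[of G]
  note dl = integral_group_ring_mult_add(1)[where G = G] and dr = integral_group_ring_mult_add(2)[where G = G]
  note dl' = integral_group_ring_mult_diff(1)[where G = G] and dr' = integral_group_ring_mult_diff(2)[where G = G]
  have zl: "0 \<otimes>\<^bsub>?R\<^esub> c = 0" "c \<otimes>\<^bsub>?R\<^esub> 0 = 0" for c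
    using dl'[where a = 0 and b = 0 and c = c] dr'[where a = 0 and b = 0 and c = c] by simp_all
  have of: "frag_of x \<otimes>\<^bsub>?R\<^esub> frag_of y = frag_of (x \<otimes>\<^bsub>G\<^esub> y)" for x y
    by (simp add: mu)
  have cl: "a \<otimes>\<^bsub>?R\<^esub> b \<in> carrier ?R" if "a \<in> carrier ?R" "b \<in> carrier ?R" for a b
  proof -
    have *: "Poly_Mapping.keys (frag_extend (\<lambda>y. frag_of (x \<otimes>\<^bsub>G\<^esub> y)) b) \<subseteq> carrier G"
      if "x \<in> carrier G" for x
      using keys_frag_extend[of "\<lambda>y. frag_of (x \<otimes>\<^bsub>G\<^esub> y)" b] that \<open>b \<in> _\<close> by (force simp: car)
    then show ?thesis
      using keys_frag_extend[of "\<lambda>x. frag_extend (\<lambda>y. frag_of (x \<otimes>\<^bsub>G\<^esub> y)) b" a] that(1)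
      unfolding car mu mem_Collect_eq by blast
  qed
  have as1: "(frag_of x \<otimes>\<^bsub>?R\<^esub> frag_of y) \<otimes>\<^bsub>?R\<^esub> c = frag_of x \<otimes>\<^bsub>?R\<^esub> (frag_of y \<otimes>\<^bsub>?R\<^esub> c)"
    if "Poly_Mapping.keys c \<subseteq> carrier G" "x \<in> carrier G" "y \<in> carrier G" for x y c
    using that(1) by (induction c rule: frag_induction) (simp_all add: zl of dr' that G.m_assoc)
  have as2: "(frag_of x \<otimes>\<^bsub>?R\<^esub> b) \<otimes>\<^bsub>?R\<^esub> c = frag_of x \<otimes>\<^bsub>?R\<^esub> (b \<otimes>\<^bsub>?R\<^esub> c)"
    if "Poly_Mapping.keys b \<subseteq> carrier G" "Poly_Mapping.keys c \<subseteq> carrier G" "x \<in> carrier G" for x b c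
    using that(1) by (induction b rule: frag_induction) (simp_all add: zl dl' dr' that as1)
  have as: "(a \<otimes>\<^bsub>?R\<^esub> b) \<otimes>\<^bsub>?R\<^esub> c = a \<otimes>\<^bsub>?R\<^esub> (b \<otimes>\<^bsub>?R\<^esub> c)"
    if "Poly_Mapping.keys a \<subseteq> carrier G" "Poly_Mapping.keys b \<subseteq> carrier G"
      "Poly_Mapping.keys c \<subseteq> carrier G" for a b c
    using that(1) by (induction a rule: frag_induction) (simp_all add: zl dl' that as2)
  have l1: "\<one>\<^bsub>?R\<^esub> \<otimes>\<^bsub>?R\<^esub> c = c" "c \<otimes>\<^bsub>?R\<^esub> \<one>\<^bsub>?R\<^esub> = c"
    if "Poly_Mapping.keys c \<subseteq> carrier G" for c
    using that by (induction c rule: frag_induction) (simp_all add: on zl of dr' dl')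
  have neg: "\<exists>y\<in>carrier ?R. y \<oplus>\<^bsub>?R\<^esub> x = \<zero>\<^bsub>?R\<^esub>" if "x \<in> carrier ?R" for x
    using that by (intro bexI[of _ "- x"]) (auto simp: car ad ze)
  have pl: "x + y \<in> carrier ?R" if "x \<in> carrier ?R" "y \<in> carrier ?R" for x y
    using that keys_add[of x y] by (auto simp: car)
  show ?thesis
  proof (rule ringI)
    show "abelian_group ?R"
      by (rule abelian_groupI) (use neg pl in \<open>auto simp: ad ze add_ac car\<close>)
    show "monoid ?R"
      by (rule monoidI) (use cl as l1 in \<open>auto simp: car on\<close>)
  qed (auto simp: ad dl dr)
qed

lemma ex_hom_integral_group_ring:
  assumes G: "group G" and g: "g \<in> carrier G" and gen: "carrier G = generate G {g}"
    and m: "Coset.order G = m" "m > 0" and \<theta>: "\<theta> ^ m = 1"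
  shows "\<exists>\<pi> \<in> ring_hom (integral_group_ring G) (int_adjoin \<theta>). \<pi> (frag_of g) = \<theta>"
proof -
  interpret G: group G by fact
  let ?R = "integral_group_ring G" and ?Z = "generate_ring ring_of_type_algebra {\<theta>}"
  interpret Z: ring "int_adjoin \<theta>" by (rule ring_int_adjoin)
  have fin: "finite (carrier G)" using m by (metis G.order_gt_0_iff_finite)
  have car: "carrier ?R = {a. Poly_Mapping.keys a \<subseteq> carrier G}"
    by (simp add: integral_group_ring_def)
  have Zc: "carrier (int_adjoin \<theta>) = ?Z" by (simp add: int_adjoin_def)
  have Zops: "\<And>a b. a \<oplus>\<^bsub>int_adjoin \<theta>\<^esub> b = a + b" "\<And>a b. a \<otimes>\<^bsub>int_adjoin \<theta>\<^esub> b = a * b"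
      "\<one>\<^bsub>int_adjoin \<theta>\<^esub> = 1" "\<zero>\<^bsub>int_adjoin \<theta>\<^esub> = 0"
    by (simp_all add: int_adjoin_def ring_of_type_algebra_def)
  have Zm: "a * b \<in> ?Z" "a + b \<in> ?Z" if "a \<in> ?Z" "b \<in> ?Z" for a b
    using Z.m_closed[of a b] Z.a_closed[of a b] that by (auto simp: Zc Zops)
  have Z01: "0 \<in> ?Z" "1 \<in> ?Z" using Z.zero_closed Z.one_closed by (auto simp: Zc Zops)
  have Zd: "a - b \<in> ?Z" if "a \<in> ?Z" "b \<in> ?Z" for a b
  proof -
    let ?nb = "\<ominus>\<^bsub>int_adjoin \<theta>\<^esub> b"
    have "?nb + b = 0" "?nb \<in> ?Z" using Z.l_neg[of b] Z.a_inv_closed[of b] that by (auto simp: Zc Zops)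
    then have "?nb = - b" by (simp add: eq_neg_iff_add_eq_0)
    then show ?thesis using Zm(2)[of a ?nb] \<open>?nb \<in> ?Z\<close> that by simp
  qed
  have \<theta>Z: "\<theta> ^ k \<in> ?Z" for k
    by (induction k) (auto intro: Zm Z01 generate_ring.incl)
  have ord: "G.ord g = m"
    using G.generate_pow_card[OF g] gen m by (simp add: Coset.order_def)
  have pw: "\<exists>k::nat. x = g [^]\<^bsub>G\<^esub> k" if "x \<in> carrier G" for x
    using that gen G.generate_pow_nat[OF g] ord m by auto
  define f where "f x = \<theta> ^ (SOME k. x = g [^]\<^bsub>G\<^esub> k)" for x
  have fpow: "f (g [^]\<^bsub>G\<^esub> j) = \<theta> ^ j" for j :: nat
  proof -
    let ?k = "SOME k::nat. g [^]\<^bsub>G\<^esub> j = g [^]\<^bsub>G\<^esub> k"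
    have "g [^]\<^bsub>G\<^esub> j = g [^]\<^bsub>G\<^esub> ?k" by (rule someI[of _ j]) simp
    then have "?k mod m = j mod m" using G.int_pow_eq[OF g, of "int j" "int ?k"] ord
      by (simp add: int_pow_int) (metis mod_eq_dvd_iff of_nat_eq_iff zmod_int)
    moreover have "\<theta> ^ k = \<theta> ^ (k mod m)" for k
      by (metis \<theta> mult_div_mod_eq power_add power_mult power_one mult_1)
    ultimately show ?thesis unfolding f_def by metis
  qed
  have fm: "f (x \<otimes>\<^bsub>G\<^esub> y) = f x * f y" if xy: "x \<in> carrier G" "y \<in> carrier G" for x y
  proof -
    obtain i j :: nat where "x = g [^]\<^bsub>G\<^esub> i" "y = g [^]\<^bsub>G\<^esub> j" using pw xy by metis
    then show ?thesis using g by (simp add: G.nat_pow_mult fpow power_add)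
  qed
  have fZ: "f x \<in> ?Z" for x unfolding f_def by (rule \<theta>Z)
  define L where "L a = (\<Sum>x\<in>carrier G. of_int (Poly_Mapping.lookup a x) * f x)" for a
  have Ladd: "L (a + b) = L a + L b" and Ldiff: "L (a - b) = L a - L b" for a b
    by (simp_all add: L_def lookup_add lookup_minus algebra_simps sum.distrib sum_subtractf)
  have L0: "L 0 = 0" by (simp add: L_def)
  have Lof: "L (frag_of x) = f x" if "x \<in> carrier G" for x
  proof -
    have "L (frag_of x) = (\<Sum>y\<in>carrier G. if x = y then f y else 0)"
      unfolding L_def by (rule sum.cong) (auto simp: lookup_single when_def)
    then show ?thesis using fin that by simp
  qed
  have LZ: "L a \<in> ?Z" if "Poly_Mapping.keys a \<subseteq> carrier G" for a
    using that by (induction a rule: frag_induction) (auto simp: L0 Z01 Lof fZ Ldiff intro: Zd)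
  note md = integral_group_ring_mult_diff[where G = G]
  have m0: "0 \<otimes>\<^bsub>?R\<^esub> c = 0" "c \<otimes>\<^bsub>?R\<^esub> 0 = 0" for c
    using md[where a = 0 and b = 0 and c = c] by simp_all
  have Lm1: "L (frag_of x \<otimes>\<^bsub>?R\<^esub> b) = f x * L b"
    if "Poly_Mapping.keys b \<subseteq> carrier G" "x \<in> carrier G" for x b
    using that(1)
  proof (induction b rule: frag_induction)
    case (one y)
    then show ?case using that(2) by (simp add: integral_group_ring_mult Lof fm)
  qed (simp_all add: m0 md L0 Ldiff right_diff_distrib)
  have Lm: "L (a \<otimes>\<^bsub>?R\<^esub> b) = L a * L b"
    if "Poly_Mapping.keys a \<subseteq> carrier G" "Poly_Mapping.keys b \<subseteq> carrier G" for a b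
    using that(1)
    by (induction a rule: frag_induction)
      (simp_all add: m0 md L0 Ldiff left_diff_distrib Lm1 Lof that(2))
  have "L \<in> ring_hom ?R (int_adjoin \<theta>)"
  proof (rule ring_hom_memI)
    have "f \<one>\<^bsub>G\<^esub> = 1" using fpow[of 0] by simp
    then show "L \<one>\<^bsub>?R\<^esub> = \<one>\<^bsub>int_adjoin \<theta>\<^esub>"
      by (simp add: Zops integral_group_ring_def Lof)
    show "L (x \<oplus>\<^bsub>?R\<^esub> y) = L x \<oplus>\<^bsub>int_adjoin \<theta>\<^esub> L y" for x y
      by (simp add: Zops) (simp add: integral_group_ring_def Ladd)
  qed (use LZ Lm in \<open>auto simp: car Zc Zops\<close>)
  moreover have "L (frag_of g) = \<theta>" using Lof[OF g] fpow[of 1] g by simp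
  ultimately show ?thesis by blast
qed

end

theory Submission
  imports Defs
begin

text \<open>
  Write \<open>U\<close> for the normalized units and \<open>\<pi>\<close> for the given homomorphism. The map \<open>u \<mapsto> (\<rho> u, \<pi> u)\<close> is
  the required isomorphism as soon as there is a retraction \<open>\<rho>\<close> of \<open>U\<close> onto the kernel of \<open>\<pi>\<close>
  (\<open>iso_kernel_times_image\<close>). Such a retraction exists because the image of \<open>\<pi>\<close> is the product of
  a free abelian group, over which any extension of abelian groups splits, and the cyclic group
  generated by \<open>\<theta>\<close>, which lifts to the cyclic group generated by \<open>g\<close>.

  Freeness comes from the logarithmic embedding of Dirichlet's unit theorem, of which only
  discreteness is used. For \<open>j\<close> prime to \<open>p\<close> let \<open>\<chi> j\<close> be the evaluation that sends \<open>g\<close> to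
  \<open>\<theta> ^ j\<close>. The additive characters \<open>u \<mapsto> ln \<bar>\<chi> j u\<bar>\<close> of \<open>U\<close> have discrete values
  (\<open>bounded_conjugates_finite\<close>), and any homomorphism defined on the common kernel \<open>K\<close> of finitely many
  characters with discrete values extends to the whole group (\<open>extend_hom_from_discrete_kernel\<close>). It
  remains to find a retraction on \<open>K\<close>. Two facts make this possible. First, \<open>\<pi>\<close> maps \<open>K\<close> into the
  powers of \<open>\<theta>\<close> (\<open>unimodular_imp_power\<close>), so \<open>u \<mapsto> u * g ^ e\<close> with \<open>\<pi> u * \<theta> ^ e = 1\<close> works. Secondly, \<open>K\<close>
  contains the kernel of \<open>\<pi>\<close> (\<open>character_conjugate_trivial\<close>); this is the irreducibility of the
  cyclotomic polynomial, by Eisenstein's criterion.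

  Both the discreteness and the statement about \<open>K\<close> rest on one identity. Put \<open>q = p ^ (n - 1)\<close>. For
  \<open>u\<close> with coefficients \<open>a i\<close>, the sum of the numbers \<open>\<bar>\<chi> j u\<bar>\<^sup>2\<close> is \<open>q / 2\<close> times the sum of
  \<open>(a i - a i')\<^sup>2\<close> over all pairs of indices that agree modulo \<open>q\<close> (\<open>sum_norm_conjugates\<close>). Bounded
  conjugates therefore bound these differences, on which alone \<open>\<pi> u\<close> depends. If all conjugates have
  norm 1, the sum over the pairs takes its least positive value, which forces all differences to
  come from a single coefficient that is off by 1; so \<open>\<pi> u\<close> is a power of \<open>\<theta>\<close> up to sign, and
  the augmentation settles the sign.
\<close>

section \<open>Splitting off kernels of discrete characters\<close>

lemma (in group)
  fixes l :: "'a \<Rightarrow> real"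
  assumes add: "\<And>x y. \<lbrakk>x \<in> carrier G; y \<in> carrier G\<rbrakk> \<Longrightarrow> l (x \<otimes> y) = l x + l y"
  shows additive_one: "l \<one> = 0"
    and additive_inv: "x \<in> carrier G \<Longrightarrow> l (inv x) = - l x"
    and additive_int_pow: "x \<in> carrier G \<Longrightarrow> l (x [^] (k::int)) = k * l x"
proof -
  show l1: "l \<one> = 0" using add[of \<one> \<one>] by simp
  show linv: "l (inv x) = - l x" if "x \<in> carrier G" for x
    using add[of x "inv x"] that l1 by (simp add: r_inv)
  have n: "l (x [^] (k::nat)) = k * l x" if "x \<in> carrier G" for x k
    by (induction k) (use that in \<open>simp_all add: l1 add algebra_simps\<close>)
  show "l (x [^] (k::int)) = k * l x" if "x \<in> carrier G"
    by (cases k rule: int_cases2) (use that n in \<open>simp_all add: int_pow_int int_pow_neg linv\<close>)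
qed

text \<open>
  A discrete subgroup of the real line is cyclic: division with remainder by its least positive
  element \<open>l w\<close> leaves no remainder. Stated for an additive character, this splits the group into
  the kernel of \<open>l\<close> and the infinite cyclic group generated by \<open>w\<close>.
\<close>

lemma (in comm_group) infinite_cyclic_complement:
  fixes l :: "'a \<Rightarrow> real"
  assumes add: "\<And>x y. \<lbrakk>x \<in> carrier G; y \<in> carrier G\<rbrakk> \<Longrightarrow> l (x \<otimes> y) = l x + l y"
    and fin: "\<And>M. finite {l x | x. x \<in> carrier G \<and> \<bar>l x\<bar> \<le> M}"
    and v: "v \<in> carrier G" "l v \<noteq> 0"
  obtains w where "w \<in> carrier G" "l w > 0" "\<And>x. x \<in> carrier G \<Longrightarrow> l x = \<lfloor>l x / l w\<rfloor> * l w"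
proof -
  note linv = additive_inv[OF add] and lpow = additive_int_pow[OF add]
  define P where "P = {l x | x. x \<in> carrier G \<and> \<bar>l x\<bar> \<le> \<bar>l v\<bar>} \<inter> {0<..}"
  have "\<bar>l v\<bar> \<in> P"
  proof (cases "l v > 0")
    case False
    then have "\<bar>l v\<bar> = l (inv v)" using v linv by simp
    then show ?thesis using v unfolding P_def by auto
  qed (use v in \<open>auto simp: P_def\<close>)
  moreover have "finite P" using fin by (simp add: P_def)
  ultimately have "Min P \<in> P" using Min_in by blast
  then obtain w where w: "w \<in> carrier G" "l w = Min P" "l w > 0" "l w \<le> \<bar>l v\<bar>" by (auto simp: P_def)
  have "l x = \<lfloor>l x / l w\<rfloor> * l w" if x: "x \<in> carrier G" for x
  proof -
    define k where "k = \<lfloor>l x / l w\<rfloor>"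
    let ?y = "x \<otimes> w [^] (- k)"
    have y: "?y \<in> carrier G" using x w by simp
    have "l ?y = l x - k * l w" using x w add lpow[of w "- k"] by simp
    moreover have "k * l w \<le> l x" "l x < (k + 1) * l w"
      using w(3) floor_correct[of "l x / l w"]
      unfolding k_def by (simp_all only: pos_le_divide_eq pos_divide_less_eq of_int_add of_int_1)
    ultimately have *: "0 \<le> l ?y" "l ?y < l w" by (auto simp: algebra_simps)
    have "\<not> 0 < l ?y"
    proof
      assume "0 < l ?y"
      then have "l ?y \<in> P" using * w y unfolding P_def by (intro IntI CollectI exI[of _ ?y]) auto
      then have "Min P \<le> l ?y" using \<open>finite P\<close> by simp
      then show False using * w by simp
    qed
    then show ?thesis using * \<open>l ?y = _\<close> by (simp add: k_def)
  qed
  then show ?thesis using that w by blast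
qed

text \<open>
  The characters \<open>l i\<close> map the group onto a discrete subgroup of \<open>\<real>\<^sup>I\<close>. Such a subgroup is free
  abelian of finite rank, so the common kernel is a direct factor and every homomorphism defined
  on it extends. The induction is Gaussian elimination on the characters: a character \<open>l d\<close> with
  \<open>l d v \<noteq> 0\<close> is subtracted from the others so that they vanish at \<open>v\<close>. The new characters \<open>\<mu> i\<close>
  still have discrete values, because translating by powers of \<open>v\<close> leaves them unchanged and makes
  \<open>l d\<close> bounded. On their common kernel \<open>K\<close> all old characters are multiples of \<open>l d\<close>, so
  \<open>K\<close> is the old common kernel times an infinite cyclic group; \<open>f\<close> extends to \<open>K\<close> by ignoring the
  cyclic factor, and the induction hypothesis extends it from \<open>K\<close> to the whole group.
  Discreteness is expressed by a finite set \<open>S\<close> that realises all bounded vectors of values;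
  \<open>S\<close> may leave the carrier, since only the values count.
\<close>

lemma (in comm_group) extend_hom_from_discrete_kernel:
  fixes l :: "'i \<Rightarrow> 'a \<Rightarrow> real" and H :: "('c, 'd) monoid_scheme" and f :: "'a \<Rightarrow> 'c"
  assumes "finite I"
    and "\<And>i x y. \<lbrakk>i \<in> I; x \<in> carrier G; y \<in> carrier G\<rbrakk> \<Longrightarrow> l i (x \<otimes> y) = l i x + l i y"
    and "\<And>M. \<exists>S. finite S \<and> (\<forall>x\<in>carrier G. (\<forall>i\<in>I. \<bar>l i x\<bar> \<le> M) \<longrightarrow> (\<exists>s\<in>S. \<forall>i\<in>I. l i x = l i s))"
    and "\<And>x. \<lbrakk>x \<in> carrier G; \<forall>i\<in>I. l i x = 0\<rbrakk> \<Longrightarrow> f x \<in> carrier H"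
    and "\<And>x y. \<lbrakk>x \<in> carrier G; \<forall>i\<in>I. l i x = 0; y \<in> carrier G; \<forall>i\<in>I. l i y = 0\<rbrakk>
      \<Longrightarrow> f (x \<otimes> y) = f x \<otimes>\<^bsub>H\<^esub> f y"
  shows "\<exists>F \<in> hom G H. \<forall>x\<in>carrier G. (\<forall>i\<in>I. l i x = 0) \<longrightarrow> F x = f x"
  using assms
proof (induction I arbitrary: l f rule: finite_induct)
  case empty
  then show ?case by (intro bexI[of _ f]) (auto intro: homI)
next
  case (insert d I)
  note add = insert.prems(1) and disc = insert.prems(2) and fc = insert.prems(3) and fm = insert.prems(4)
  show ?case
  proof (cases "\<forall>x\<in>carrier G. l d x = 0")
    case True
    have "\<exists>F \<in> hom G H. \<forall>x\<in>carrier G. (\<forall>i\<in>I. l i x = 0) \<longrightarrow> F x = f x"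
    proof (rule insert.IH)
      fix M
      obtain S where "finite S" and S: "\<And>x. \<lbrakk>x \<in> carrier G; \<forall>i\<in>insert d I. \<bar>l i x\<bar> \<le> max M 0\<rbrakk> 
          \<Longrightarrow> \<exists>s\<in>S. \<forall>i\<in>insert d I. l i x = l i s"
        using disc[of "max M 0"] by blast
      have "\<exists>s\<in>S. \<forall>i\<in>I. l i x = l i s" if "x \<in> carrier G" "\<forall>i\<in>I. \<bar>l i x\<bar> \<le> M" for x
      proof -
        have "\<forall>i\<in>insert d I. \<bar>l i x\<bar> \<le> max M 0" using True that by (auto simp: le_max_iff_disj)
        from S[OF that(1) this] show ?thesis by blast
      qed
      then show "\<exists>S. finite S \<and> (\<forall>x\<in>carrier G. (\<forall>i\<in>I. \<bar>l i x\<bar> \<le> M) \<longrightarrow> (\<exists>s\<in>S. \<forall>i\<in>I. l i x = l i s))"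
        using \<open>finite S\<close> by blast
    qed (use True add fc fm in auto)
    then show ?thesis by auto
  next
    case False
    then obtain v where v: "v \<in> carrier G" "l d v \<noteq> 0" by blast
    define c where "c i = l i v / l d v" for i
    define \<mu> where "\<mu> i x = l i x - c i * l d x" for i x
    have \<mu>_add: "\<mu> i (x \<otimes> y) = \<mu> i x + \<mu> i y" if "i \<in> I" "x \<in> carrier G" "y \<in> carrier G" for i x y
      using that by (simp add: \<mu>_def add algebra_simps)
    have lone: "l i \<one> = 0" if "i \<in> insert d I" for i
      using additive_one[of "l i"] add that by blast
    have linv: "l i (inv x) = - l i x" if "i \<in> insert d I" "x \<in> carrier G" for i x
      using additive_inv[of "l i" x] add that by blast
    have lpow: "l i (x [^] k) = k * l i x" if "i \<in> insert d I" "x \<in> carrier G" for i x and k :: int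
      using additive_int_pow[of "l i" x k] add that by blast
    define K where "K = {x \<in> carrier G. \<forall>i\<in>I. \<mu> i x = 0}"
    have lK: "l i x = c i * l d x" if "x \<in> K" "i \<in> I" for i x
      using that by (auto simp: K_def \<mu>_def)
    have "subgroup K G"
    proof
      fix x assume "x \<in> K"
      then show "inv x \<in> K" by (auto simp: K_def \<mu>_def linv)
    qed (auto simp: K_def \<mu>_add, auto simp: \<mu>_def lone)
    then interpret K: group "G\<lparr>carrier := K\<rparr>" using subgroup.subgroup_is_group is_group by blast
    interpret K: comm_group "G\<lparr>carrier := K\<rparr>"
      by (rule K.group_comm_groupI) (auto simp: K_def m_comm)
    have vK: "v \<in> K" using v by (auto simp: K_def \<mu>_def c_def)
    obtain w where w: "w \<in> K" "l d w > 0"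
        and lw: "\<And>x. x \<in> K \<Longrightarrow> l d x = \<lfloor>l d x / l d w\<rfloor> * l d w"
    proof (rule K.infinite_cyclic_complement[of "l d" v])
      fix M
      define M' where "M' = (\<Sum>i\<in>I. \<bar>c i\<bar> * \<bar>M\<bar>) + \<bar>M\<bar>"
      obtain S where "finite S" and S: "\<And>x. \<lbrakk>x \<in> carrier G; \<forall>i\<in>insert d I. \<bar>l i x\<bar> \<le> M'\<rbrakk>
          \<Longrightarrow> \<exists>s\<in>S. \<forall>i\<in>insert d I. l i x = l i s"
        using disc[of M'] by blast
      have "{l d x |x. x \<in> carrier (G\<lparr>carrier := K\<rparr>) \<and> \<bar>l d x\<bar> \<le> M} \<subseteq> l d ` S"
      proof clarsimp
        fix x assume x: "x \<in> K" "\<bar>l d x\<bar> \<le> M"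
        have "\<bar>l i x\<bar> \<le> M'" if "i \<in> insert d I" for i
        proof (cases "i = d")
          case True
          then show ?thesis using x(2) by (simp add: M'_def sum_nonneg add_increasing)
        next
          case False
          then have i: "i \<in> I" using that by simp
          have "\<bar>l i x\<bar> = \<bar>c i\<bar> * \<bar>l d x\<bar>" using lK[OF x(1) i] by (simp add: abs_mult)
          also have "\<dots> \<le> \<bar>c i\<bar> * \<bar>M\<bar>" using x(2) by (intro mult_left_mono) auto
          also have "\<dots> \<le> (\<Sum>i\<in>I. \<bar>c i\<bar> * \<bar>M\<bar>)"
            by (rule member_le_sum) (use i insert.hyps in auto)
          finally show ?thesis by (simp add: M'_def)
        qed
        then show "l d x \<in> l d ` S" using S[of x] x by (auto simp: K_def)
      qed
      then show "finite {l d x |x. x \<in> carrier (G\<lparr>carrier := K\<rparr>) \<and> \<bar>l d x\<bar> \<le> M}"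
        using \<open>finite S\<close> finite_subset by blast
    qed (use vK v add in \<open>auto simp: K_def\<close>)
    \<comment> \<open>the exponent of the cyclic factor, and the extension that drops this factor\<close>
    define e where "e x = \<lfloor>l d x / l d w\<rfloor>" for x
    define f' where "f' x = f (x \<otimes> w [^] (- e x))" for x
    have wc: "w \<in> carrier G" using w by (simp add: K_def)
    have kill: "x \<otimes> w [^] (- e x) \<in> carrier G \<and> (\<forall>i\<in>insert d I. l i (x \<otimes> w [^] (- e x)) = 0)"
      if x: "x \<in> K" for x
    proof -
      have xc: "x \<in> carrier G" using x by (simp add: K_def)
      have 0: "l d (x \<otimes> w [^] (- e x)) = 0"
        using add[of d x "w [^] (- e x)"] lpow[of d w "- e x"] lw[OF x] wc xc by (simp add: e_def)
      have "x \<otimes> w [^] (- e x) \<in> K"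
        using x w \<open>subgroup K G\<close> int_pow_closed K.int_pow_closed[of w "- e x"] 
          int_pow_consistent[OF \<open>subgroup K G\<close>, of w] K.m_closed[of x "w [^] (- e x)"] by simp
      then show ?thesis using 0 lK by (auto simp: K_def)
    qed
    have "\<exists>F \<in> hom G H. \<forall>x\<in>carrier G. (\<forall>i\<in>I. \<mu> i x = 0) \<longrightarrow> F x = f' x"
    proof (rule insert.IH)
      fix M
      define M' where "M' = \<bar>M\<bar> + (\<Sum>i\<in>I. \<bar>c i\<bar> * \<bar>l d v\<bar>) + \<bar>l d v\<bar>"
      obtain S where "finite S" and S: "\<And>x. \<lbrakk>x \<in> carrier G; \<forall>i\<in>insert d I. \<bar>l i x\<bar> \<le> M'\<rbrakk>
          \<Longrightarrow> \<exists>s\<in>S. \<forall>i\<in>insert d I. l i x = l i s"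
        using disc[of M'] by blast
      have "\<exists>s\<in>S. \<forall>i\<in>I. \<mu> i x = \<mu> i s" if x: "x \<in> carrier G" "\<forall>i\<in>I. \<bar>\<mu> i x\<bar> \<le> M" for x
      proof -
        \<comment> \<open>translate by a power of v: this bounds \<open>l d\<close> without changing any \<open>\<mu> i\<close>\<close>
        define k where "k = \<lfloor>l d x / l d v\<rfloor>"
        define y where "y = x \<otimes> v [^] (- k)"
        have y: "y \<in> carrier G" using x v by (simp add: y_def)
        have ly: "l i y = l i x - k * l i v" if "i \<in> insert d I" for i
          using that add[of i x "v [^] (- k)"] lpow[of i v "- k"] x v by (simp add: y_def)
        have \<mu>y: "\<mu> i y = \<mu> i x" if "i \<in> I" for i
          using that v(2) by (simp add: \<mu>_def ly c_def field_simps)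
        have "l d y = (l d x / l d v - k) * l d v" using v(2) ly by (simp add: left_diff_distrib)
        moreover have "\<bar>l d x / l d v - k\<bar> \<le> 1" 
          using floor_correct[of "l d x / l d v"] by (simp add: k_def abs_le_iff) linarith
        ultimately have ldy: "\<bar>l d y\<bar> \<le> \<bar>l d v\<bar>" by (simp add: abs_mult mult_left_le_one_le)
        have "\<bar>l i y\<bar> \<le> M'" if "i \<in> insert d I" for i
        proof (cases "i = d")
          case True
          then show ?thesis using ldy by (simp add: M'_def sum_nonneg add_increasing)
        next
          case False
          then have i: "i \<in> I" using that by simp
          have "\<bar>c i * l d y\<bar> \<le> \<bar>c i\<bar> * \<bar>l d v\<bar>" using ldy by (simp add: abs_mult mult_left_mono)
          also have "\<dots> \<le> (\<Sum>i\<in>I. \<bar>c i\<bar> * \<bar>l d v\<bar>)"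
            by (rule member_le_sum) (use i insert.hyps in auto)
          moreover have "l i y = \<mu> i x + c i * l d y" using \<mu>y[OF i] by (simp add: \<mu>_def)
          moreover have "\<bar>\<mu> i x\<bar> \<le> \<bar>M\<bar>" using x i by force
          ultimately show ?thesis
            using abs_triangle_ineq[of "\<mu> i x" "c i * l d y"] abs_ge_zero[of "l d v"]
            unfolding M'_def by linarith
        qed
        then obtain s where "s \<in> S" "\<forall>i\<in>insert d I. l i y = l i s" using S[OF y] by blast
        then show ?thesis using \<mu>y by (intro bexI[of _ s]) (auto simp: \<mu>_def)
      qed
      then show "\<exists>S. finite S \<and> (\<forall>x\<in>carrier G. (\<forall>i\<in>I. \<bar>\<mu> i x\<bar> \<le> M) \<longrightarrow> (\<exists>s\<in>S. \<forall>i\<in>I. \<mu> i x = \<mu> i s))"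
        using \<open>finite S\<close> by blast
    next
      fix x assume "x \<in> carrier G" "\<forall>i\<in>I. \<mu> i x = 0"
      then show "f' x \<in> carrier H" using kill[of x] fc unfolding f'_def K_def by blast
    next
      fix x y assume "x \<in> carrier G" "\<forall>i\<in>I. \<mu> i x = 0" "y \<in> carrier G" "\<forall>i\<in>I. \<mu> i y = 0"
      then have xy: "x \<in> K" "y \<in> K" "x \<in> carrier G" "y \<in> carrier G" by (auto simp: K_def)
      have "l d (x \<otimes> y) / l d w = of_int (e x + e y)"
        using lw[OF xy(1)] lw[OF xy(2)] w(2) add[of d x y] xy by (simp add: e_def field_simps)
      then have "e (x \<otimes> y) = e x + e y" unfolding e_def by (metis floor_of_int)
      then have "x \<otimes> y \<otimes> w [^] (- e (x \<otimes> y)) = (x \<otimes> w [^] (- e x)) \<otimes> (y \<otimes> w [^] (- e y))"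
        using xy wc by (simp add: int_pow_mult m_ac flip: int_pow_mult)
      then show "f' (x \<otimes> y) = f' x \<otimes>\<^bsub>H\<^esub> f' y"
        unfolding f'_def using fm kill[OF xy(1)] kill[OF xy(2)] by simp
    qed (rule \<mu>_add)
    then obtain F where F: "F \<in> hom G H" "\<And>x. \<lbrakk>x \<in> carrier G; \<forall>i\<in>I. \<mu> i x = 0\<rbrakk> \<Longrightarrow> F x = f' x" by blast
    show ?thesis
    proof (intro bexI[of _ F] ballI impI)
      fix x assume x: "x \<in> carrier G" "\<forall>i\<in>insert d I. l i x = 0"
      then have "F x = f' x" by (intro F) (auto simp: \<mu>_def)
      then show "F x = f x" using x by (simp add: f'_def e_def)
    qed (rule F)
  qed
qed

text \<open>
  A retraction \<open>\<rho>\<close> onto the kernel splits the extension: the isomorphism is \<open>x \<mapsto> (\<rho> x, \<pi> x)\<close>. It is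
  injective because elements with the same image differ by some \<open>d\<close> in the kernel, and \<open>\<rho>\<close> sees
  \<open>d\<close>; it is surjective because any \<open>v\<close> can be corrected by the kernel element \<open>inv (\<rho> v) \<otimes> k\<close>
  without changing \<open>\<pi> v\<close>.
\<close>

lemma iso_kernel_times_image:
  assumes "comm_group U" and "group V" and "\<pi> \<in> hom U V"
    and N: "N = kernel U V \<pi>"
    and \<rho>: "\<rho> \<in> hom U (U\<lparr>carrier := N\<rparr>)" "\<And>x. x \<in> N \<Longrightarrow> \<rho> x = x"
  shows "U \<cong> U\<lparr>carrier := N\<rparr> \<times>\<times> V\<lparr>carrier := \<pi> ` carrier U\<rparr>"
proof -
  interpret U: comm_group U by fact
  interpret group_hom U V \<pi> by (intro group_hom.intro group_hom_axioms.intro U.is_group assms)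
  have \<rho>c: "\<rho> x \<in> N" if "x \<in> carrier U" for x using \<rho> that by (auto simp: hom_def)
  have \<rho>m: "\<rho> (x \<otimes>\<^bsub>U\<^esub> y) = \<rho> x \<otimes>\<^bsub>U\<^esub> \<rho> y" if "x \<in> carrier U" "y \<in> carrier U" for x y
    using \<rho> that by (auto simp: hom_def)
  have Nc: "x \<in> carrier U" "\<pi> x = \<one>\<^bsub>V\<^esub>" if "x \<in> N" for x using that by (auto simp: N kernel_def)
  have "(\<lambda>x. (\<rho> x, \<pi> x)) \<in> iso U (U\<lparr>carrier := N\<rparr> \<times>\<times> V\<lparr>carrier := \<pi> ` carrier U\<rparr>)"
  proof (rule isoI)
    show "(\<lambda>x. (\<rho> x, \<pi> x)) \<in> hom U (U\<lparr>carrier := N\<rparr> \<times>\<times> V\<lparr>carrier := \<pi> ` carrier U\<rparr>)"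
      by (rule homI) (auto simp: \<rho>c \<rho>m)
    show "bij_betw (\<lambda>x. (\<rho> x, \<pi> x)) (carrier U) (carrier (U\<lparr>carrier := N\<rparr> \<times>\<times> V\<lparr>carrier := \<pi> ` carrier U\<rparr>))"
    proof (rule bij_betw_imageI)
      show "inj_on (\<lambda>x. (\<rho> x, \<pi> x)) (carrier U)"
      proof (rule inj_onI, clarsimp)
        fix x y assume xy: "x \<in> carrier U" "y \<in> carrier U" "\<rho> x = \<rho> y" "\<pi> x = \<pi> y"
        let ?d = "x \<otimes>\<^bsub>U\<^esub> inv\<^bsub>U\<^esub> y"
        have d: "?d \<in> N" using xy by (simp add: N kernel_def)
        have "x = ?d \<otimes>\<^bsub>U\<^esub> y" using xy by (simp add: U.m_assoc)
        then have "\<rho> x = ?d \<otimes>\<^bsub>U\<^esub> \<rho> x" using \<rho>m[of ?d y] \<rho>(2)[OF d] xy by simp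
        then have "?d = \<one>\<^bsub>U\<^esub>" using \<rho>c[of x] Nc xy U.r_cancel_one'[of "\<rho> x" ?d] by simp
        then show "x = y" using xy \<open>x = ?d \<otimes>\<^bsub>U\<^esub> y\<close> by simp
      qed
      show "(\<lambda>x. (\<rho> x, \<pi> x)) ` carrier U = carrier (U\<lparr>carrier := N\<rparr> \<times>\<times> V\<lparr>carrier := \<pi> ` carrier U\<rparr>)"
      proof (intro equalityI subsetI)
        fix z assume "z \<in> carrier (U\<lparr>carrier := N\<rparr> \<times>\<times> V\<lparr>carrier := \<pi> ` carrier U\<rparr>)"
        then obtain k v where z: "z = (k, \<pi> v)" "k \<in> N" "v \<in> carrier U" by auto
        have k: "k \<in> carrier U" "\<pi> k = \<one>\<^bsub>V\<^esub>" using Nc z(2) by auto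
        have rv: "\<rho> v \<in> carrier U" "\<pi> (\<rho> v) = \<one>\<^bsub>V\<^esub>" using Nc[OF \<rho>c[OF z(3)]] by auto
        define t where "t = inv\<^bsub>U\<^esub> (\<rho> v) \<otimes>\<^bsub>U\<^esub> k"
        have t: "t \<in> carrier U" "\<pi> t = \<one>\<^bsub>V\<^esub>" using k rv by (simp_all add: t_def)
        then have "t \<in> N" by (simp add: N kernel_def)
        then have "\<rho> (v \<otimes>\<^bsub>U\<^esub> t) = \<rho> v \<otimes>\<^bsub>U\<^esub> t" using \<rho>m z(3) t \<rho>(2) by simp
        also have "\<dots> = k" unfolding t_def using U.m_assoc[of "\<rho> v" "inv\<^bsub>U\<^esub> (\<rho> v)" k] k rv by simp
        finally have "z = (\<rho> (v \<otimes>\<^bsub>U\<^esub> t), \<pi> (v \<otimes>\<^bsub>U\<^esub> t))" using z(1,3) t by simp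
        then show "z \<in> (\<lambda>x. (\<rho> x, \<pi> x)) ` carrier U" using z(3) t(1) by blast
      qed (use \<rho>c in auto)
    qed
  qed
  then show ?thesis by (rule is_isoI)
qed

section \<open>Irreducibility of prime power cyclotomic polynomials\<close>

lemma poly_of_int_mult:
  "poly (map_poly of_int (f * g)) z = poly (map_poly of_int f) z * poly (map_poly of_int g) (z::'a::comm_ring_1)"
proof -
  have "poly (map_poly of_int (smult a g)) z = of_int a * poly (map_poly of_int g) z" for a
    by (simp add: map_poly_smult)
  moreover have "poly (map_poly of_int (f + g)) z = poly (map_poly of_int f) z + poly (map_poly of_int g) z" for f g
  proof -
    have "map_poly of_int (f + g) = (map_poly of_int f + map_poly of_int g :: 'a poly)"
      by (rule poly_eqI) (simp add: coeff_map_poly)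
    then show ?thesis by simp
  qed
  ultimately show ?thesis
    by (induction f) (simp_all add: map_poly_pCons algebra_simps)
qed

text \<open>
  From \<open>i * (p ^ k choose i) = p ^ k * (p ^ k - 1 choose (i - 1))\<close>: if \<open>p\<close> did not divide the
  binomial coefficient, all of \<open>p ^ k\<close> would divide \<open>i\<close>.
\<close>

lemma prime_dvd_prime_power_choose:
  fixes p :: nat
  assumes "Factorial_Ring.prime p" "0 < i" "i < p ^ k"
  shows "p dvd p ^ k choose i"
proof (rule ccontr)
  assume "\<not> p dvd p ^ k choose i"
  then have "coprime (p ^ k) (p ^ k choose i)"
    using assms(1) by (simp add: prime_imp_coprime)
  moreover have "i * (p ^ k choose i) = p ^ k * (p ^ k - 1 choose (i - 1))"
    using times_binomial_minus1_eq[of i "p ^ k"] assms by simp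
  then have "p ^ k dvd i * (p ^ k choose i)" by simp
  ultimately have "p ^ k dvd i" by (simp add: coprime_dvd_mult_left_iff)
  then show False using assms by (auto dest: dvd_imp_le)
qed

text \<open>
  Eisenstein's criterion. Since \<open>p\<^sup>2\<close> does not divide the constant coefficient, \<open>p\<close> misses the
  constant coefficient of one factor, say \<open>g\<close>. The first coefficient of the other factor that \<open>p\<close>
  misses then produces a coefficient of the product that \<open>p\<close> misses, and this can only be the
  leading one; so \<open>g\<close> is constant.
\<close>

lemma eisenstein:
  fixes A B :: "int poly" and p :: int
  assumes p: "Factorial_Ring.prime p" and monic: "lead_coeff (A * B) = 1"
    and low: "\<And>i. i < degree (A * B) \<Longrightarrow> p dvd coeff (A * B) i"
    and const: "\<not> p\<^sup>2 dvd coeff (A * B) 0"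
  shows "degree A = 0 \<or> degree B = 0"
proof -
  have *: "degree g = 0"
    if fg: "lead_coeff (f * g) = 1" "\<And>i. i < degree (f * g) \<Longrightarrow> p dvd coeff (f * g) i"
      and g0: "\<not> p dvd coeff g 0" for f g :: "int poly"
  proof -
    have "lead_coeff f dvd 1" using fg(1) by (metis lead_coeff_mult dvd_triv_left)
    then have "\<not> p dvd lead_coeff f" using p by (meson dvd_trans not_prime_unit)
    then obtain i where i: "\<not> p dvd coeff f i" "\<And>j. j < i \<Longrightarrow> p dvd coeff f j"
      using exists_least_iff[of "\<lambda>i. \<not> p dvd coeff f i"] by blast
    have "coeff (f * g) i = (\<Sum>j<i. coeff f j * coeff g (i - j)) + coeff f i * coeff g 0"
      by (simp add: coeff_mult flip: lessThan_Suc_atMost)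
    moreover have "p dvd (\<Sum>j<i. coeff f j * coeff g (i - j))"
      using i by (intro dvd_sum) simp
    moreover have "\<not> p dvd coeff f i * coeff g 0" using i(1) g0 p by (simp add: prime_dvd_mult_iff)
    ultimately have "\<not> p dvd coeff (f * g) i" by (simp add: dvd_add_right_iff)
    then have "degree (f * g) \<le> i" using fg(2) not_less by blast
    moreover have "i \<le> degree f" using i(1) by (metis coeff_eq_0 dvd_0_right not_less)
    moreover have "degree (f * g) = degree f + degree g" using fg(1) by (intro degree_mult_eq) auto
    ultimately show ?thesis by simp
  qed
  have "coeff (A * B) 0 = coeff A 0 * coeff B 0" by (simp add: coeff_mult)
  then have "\<not> p dvd coeff A 0 \<or> \<not> p dvd coeff B 0"
    using const by (auto simp: power2_eq_square mult_dvd_mono)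
  then show ?thesis
    using *[of A B] *[of B A] monic low by (auto simp: mult.commute[of B A])
qed

text \<open>
  An Eisenstein polynomial is the minimal polynomial of each of its roots, over the integers. A
  primitive integer polynomial \<open>A\<close> of least degree among those vanishing at \<open>z\<close> divides every
  such polynomial, by pseudo-division and Gauss's lemma; it divides \<open>E\<close>, so irreducibility makes
  it associated to \<open>E\<close>.
\<close>

lemma eisenstein_dvd:
  fixes E f :: "int poly" and p :: int and z :: "'a::field_char_0"
  assumes p: "Factorial_Ring.prime p" and monic: "lead_coeff E = 1"
    and low: "\<And>i. i < degree E \<Longrightarrow> p dvd coeff E i"
    and const: "\<not> p\<^sup>2 dvd coeff E 0"
    and z: "poly (map_poly of_int E) z = 0" "poly (map_poly of_int f) z = 0"
  shows "E dvd f"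
proof -
  let ?ev = "\<lambda>h. poly (map_poly of_int h) z"
  have ev_diff: "?ev (g - h) = ?ev g - ?ev h" for g h
  proof -
    have "map_poly of_int (g - h) = (map_poly of_int g - map_poly of_int h :: 'a poly)"
      by (rule poly_eqI) (simp add: coeff_map_poly)
    then show ?thesis by simp
  qed
  define V where "V = {h. h \<noteq> 0 \<and> ?ev h = 0}"
  have "E \<in> V" using monic z by (auto simp: V_def)
  then obtain A0 where A0: "A0 \<in> V" "\<And>h. h \<in> V \<Longrightarrow> degree A0 \<le> degree h"
    using arg_min_nat_lemma[of "\<lambda>h. h \<in> V" E degree] by blast
  define A where "A = primitive_part A0"
  have A0A: "A0 = smult (content A0) A" by (simp add: A_def)
  have "A \<noteq> 0" using A0(1) by (simp add: A_def V_def)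
  have "?ev A0 = of_int (content A0) * ?ev A" by (subst A0A) (simp add: map_poly_smult)
  then have evA: "?ev A = 0" using A0(1) unfolding V_def by auto
  have dA: "degree A \<le> degree h" if "h \<in> V" for h using A0(2)[OF that] by (simp add: A_def)
  have div: "A dvd h" if "?ev h = 0" for h
  proof -
    obtain q r where qr: "pseudo_divmod h A = (q, r)" by (cases "pseudo_divmod h A")
    define c where "c = lead_coeff A ^ (Suc (degree h) - degree A)"
    have eq: "smult c h = A * q + r" and r: "r = 0 \<or> degree r < degree A"
      using pseudo_divmod[OF \<open>A \<noteq> 0\<close> qr] by (simp_all add: c_def)
    have "r = smult c h - A * q" using eq by simp
    then have "?ev r = 0" using that evA by (simp add: ev_diff poly_of_int_mult map_poly_smult)
    then have "r = 0" using r dA[of r] by (fastforce simp: V_def)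
    have "content A = 1" using A0(1) by (simp add: A_def V_def)
    have "smult c h = A * q" using eq \<open>r = 0\<close> by simp
    have "normalize c * content h = content q"
      using arg_cong[OF \<open>smult c h = A * q\<close>, of content] \<open>content A = 1\<close> by (simp add: content_mult)
    then have "c dvd content q" by (metis dvd_triv_left normalize_dvd_iff)
    then obtain s where s: "q = [:c:] * s" unfolding const_poly_dvd_iff_dvd_content[symmetric] by (elim dvdE)
    have "c \<noteq> 0" using \<open>A \<noteq> 0\<close> by (simp add: c_def)
    have "smult c h = smult c (A * s)" using \<open>smult c h = A * q\<close> s by simp
    then have "[:c:] * h = [:c:] * (A * s)" by simp
    moreover have "[:c:] \<noteq> 0" using \<open>c \<noteq> 0\<close> by simp
    ultimately have "h = A * s" by (simp only: mult_left_cancel simp_thms)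
    then show ?thesis by simp
  qed
  obtain B where B: "E = A * B" using div[OF z(1)] by blast
  have "degree A \<noteq> 0"
  proof
    assume "degree A = 0"
    then obtain a where "A = [:a:]" by (rule degree_eq_zeroE)
    then show False using \<open>A \<noteq> 0\<close> evA by (simp add: map_poly_pCons)
  qed
  then have "degree B = 0" using eisenstein[OF p, of A B] monic low const by (auto simp: B)
  then obtain b where b: "B = [:b:]" by (rule degree_eq_zeroE)
  then have "b dvd 1" using monic by (metis B lead_coeff_mult dvd_triv_right degree_pCons_0 coeff_pCons_0)
  then have "B dvd 1" by (simp add: b is_unit_const_poly_iff)
  then have "E dvd A" unfolding B by (simp add: mult_unit_dvd_iff)
  then show ?thesis using div[OF z(2)] by (rule dvd_trans)
qed

text \<open>
  \<open>E\<close> is \<open>\<Phi>(X + 1)\<close> for the cyclotomic polynomial \<open>\<Phi>\<close> of order \<open>p ^ (n + 1)\<close>. It is an Eisenstein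
  polynomial: modulo \<open>p\<close> the identity \<open>\<Phi>(Y) (Y ^ q - 1) = Y ^ (p * q) - 1\<close> at \<open>Y = X + 1\<close> becomes
  \<open>E * X ^ q = X ^ (p * q)\<close>, and the constant coefficient is \<open>\<Phi>(1) = p\<close>.
\<close>

lemma shifted_cyclotomic:
  fixes p n :: nat
  assumes p: "Factorial_Ring.prime p"
  defines "q \<equiv> p ^ n" 
  defines "E \<equiv> (\<Sum>k<p. [:1, 1:] ^ (k * q)) :: int poly"
  shows "degree E = (p - 1) * q" "lead_coeff E = 1"
    "\<And>i. i < degree E \<Longrightarrow> int p dvd coeff E i" "coeff E 0 = int p"
proof -
  have p0: "p > 1" "q > 0" using prime_gt_1_nat[OF p] by (simp_all add: q_def)
  define X1 where "X1 = ([:1, 1:] :: int poly)"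
  have dX: "degree (X1 ^ k) = k" "lead_coeff (X1 ^ k) = 1" for k
    by (simp_all add: X1_def degree_power_eq coeff_linear_power)
  have "E = (\<Sum>k<p-1. X1 ^ (k * q)) + X1 ^ ((p - 1) * q)"
    using p0 sum.lessThan_Suc[of "\<lambda>k. X1 ^ (k * q)" "p - 1"] by (simp add: E_def X1_def)
  moreover have "degree (\<Sum>k<p-1. X1 ^ (k * q)) < (p - 1) * q"
    using p0 by (intro degree_sum_less) (auto simp: dX)
  ultimately show "degree E = (p - 1) * q" "lead_coeff E = 1"
    using dX[of "(p - 1) * q"] by (simp_all add: degree_add_eq_right coeff_eq_0)
  note dE = \<open>degree E = _\<close>
  have "poly E 0 = int p" by (simp add: E_def poly_sum)
  then show "coeff E 0 = int p" by (simp add: poly_0_coeff_0)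
  have mod_p: "int p dvd coeff (X1 ^ (p ^ k) - (monom 1 (p ^ k) + 1)) i" for k i
  proof -
    have "int p dvd int (p ^ k choose i)" if "0 < i" "i < p ^ k"
      using prime_dvd_prime_power_choose[OF p that] by simp
    moreover have "p ^ k > 0" using p0 by simp
    ultimately show ?thesis
      by (cases "i \<le> p ^ k")
        (auto simp: X1_def coeff_linear_poly_power coeff_eq_0 degree_power_eq)
  qed
  have "E * (X1 ^ q - 1) = X1 ^ (p * q) - 1"
    using power_diff_1_eq[of "X1 ^ q" p] 
    by (simp add: E_def X1_def power_mult mult.commute flip: power_mult)
  \<comment> \<open>the errors, divisible by p, of the congruences \<open>(X + 1) ^ N = X ^ N + 1\<close>\<close>
  define R where "R = X1 ^ q - (monom 1 q + 1)"
  define R' where "R' = X1 ^ (p * q) - (monom 1 (p * q) + 1)"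
  have R: "[:int p:] dvd R" "[:int p:] dvd R'"
    unfolding const_poly_dvd_iff using mod_p[of n] mod_p[of "Suc n"] by (auto simp: R_def R'_def q_def)
  have "E * monom 1 q - monom 1 (p * q) = R' - E * R"
    using \<open>E * _ = _\<close> by (simp add: R_def R'_def algebra_simps)
  then have "[:int p:] dvd E * monom 1 q - monom 1 (p * q)" using R by (simp add: dvd_diff)
  then have *: "int p dvd coeff (E * monom 1 q - monom 1 (p * q)) j" for j by (simp add: const_poly_dvd_iff)
  fix i assume "i < degree E"
  then have "i + q < p * q" using p0 by (simp add: dE diff_mult_distrib)
  then show "int p dvd coeff E i" using *[of "i + q"] by (simp add: coeff_monom_mult mult.commute[of E])
qed

text \<open>
  The sums in the assumptions are the values of the cyclotomic polynomial, so this says that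
  primitive \<open>p ^ (n + 1)\<close>-th roots of unity are conjugate over the rationals.
\<close>

lemma cyclotomic_conjugate:
  fixes p n :: nat and \<theta> \<eta> :: "'a::field_char_0" and f :: "int poly"
  assumes p: "Factorial_Ring.prime p"
    and \<theta>: "(\<Sum>k<p. \<theta> ^ (k * p ^ n)) = 0" and \<eta>: "(\<Sum>k<p. \<eta> ^ (k * p ^ n)) = 0"
    and f: "poly (map_poly of_int f) \<theta> = 0"
  shows "poly (map_poly of_int f) \<eta> = 0"
proof -
  define E where "E = (\<Sum>k<p. [:1, 1:] ^ (k * p ^ n) :: int poly)"
  note E = shifted_cyclotomic[where n = n, OF p, folded E_def]
  have add: "map_poly of_int (g + h) = (map_poly of_int g + map_poly of_int h :: 'a poly)" for g h
    by (rule poly_eqI) (simp add: coeff_map_poly)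
  have pw: "poly (map_poly of_int (g ^ k)) x = poly (map_poly of_int g) x ^ k" for g k and x :: 'a
    by (induction k) (simp_all add: poly_of_int_mult)
  have sum: "poly (map_poly of_int (\<Sum>k<m. F k)) x = (\<Sum>k<m. poly (map_poly of_int (F k)) x)" for F and m :: nat and x :: 'a
    by (induction m) (simp_all add: add)
  have evE: "poly (map_poly of_int E) (x - 1) = (\<Sum>k<p. x ^ (k * p ^ n))" for x :: 'a
    by (simp add: E_def sum pw map_poly_pCons)
  have ev: "poly (map_poly of_int (f \<circ>\<^sub>p [:1, 1:])) (x - 1) = poly (map_poly of_int f) x" for x :: 'a
    by (induction f) (simp_all add: pcompose_pCons add poly_of_int_mult map_poly_pCons algebra_simps)
  have "E dvd f \<circ>\<^sub>p [:1, 1:]"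
  proof (rule eisenstein_dvd[where p = "int p" and z = "\<theta> - 1"])
    show "\<not> (int p)\<^sup>2 dvd coeff E 0"
      using E(4) prime_gt_1_nat[OF p] by (simp add: power2_eq_square)
  qed (use E p \<theta> f evE ev in auto)
  then have "poly (map_poly of_int (f \<circ>\<^sub>p [:1, 1:])) (\<eta> - 1) = 0"
    using evE[of \<eta>] \<eta> by (auto elim!: dvdE simp: poly_of_int_mult)
  then show ?thesis by (simp add: ev)
qed

section \<open>Norms of conjugates in the cyclotomic ring\<close>

lemma int_square_ge_1: "1 \<le> (x::int)\<^sup>2" if "x \<noteq> 0"
  using that by (metis int_one_le_iff_zero_less zero_less_power2)

text \<open>
  Let \<open>S\<close> be the set where \<open>b\<close> takes the value \<open>b x1\<close>, with \<open>k\<close> elements, and \<open>S'\<close> its complement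
  in \<open>C\<close>, with \<open>l\<close> elements. The pairs between \<open>S\<close> and \<open>S'\<close> alone contribute at least
  \<open>2 * k * l \<ge> 2 * (k + l - 1)\<close>. Under the stated bound everything is an equality: \<open>b\<close> is constant
  on \<open>S'\<close>, the two values differ by 1, and \<open>(k - 1) * (l - 1) = 0\<close>, so one of the sets is a
  singleton.
\<close>

lemma sum_square_differences_minimal:
  fixes b :: "'c \<Rightarrow> int"
  assumes fin: "finite C" and xy: "x1 \<in> C" "x2 \<in> C" "b x1 \<noteq> b x2"
    and le: "(\<Sum>x\<in>C. \<Sum>y\<in>C. (b x - b y)\<^sup>2) \<le> 2 * (int (card C) - 1)"
  shows "(\<Sum>x\<in>C. \<Sum>y\<in>C. (b x - b y)\<^sup>2) = 2 * (int (card C) - 1)"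
    and "\<exists>x0\<in>C. \<exists>\<epsilon>\<in>{1, -1}. \<exists>\<kappa>. \<forall>x\<in>C. b x = \<kappa> + (if x = x0 then \<epsilon> else 0)"
proof -
  define S where "S = {x \<in> C. b x = b x1}"
  define S' where "S' = C - S"
  let ?D = "\<lambda>A B. \<Sum>x\<in>A. \<Sum>y\<in>B. (b x - b y)\<^sup>2"
  define k where "k = int (card S)"
  define l where "l = int (card S')"
  have C: "C = S \<union> S'" "S \<inter> S' = {}" "finite S" "finite S'" using fin by (auto simp: S_def S'_def)
  have kl: "k + l = int (card C)" using C by (simp add: k_def l_def card_Un_disjoint)
  have pos: "k \<ge> 1" "l \<ge> 1"
  proof -
    have "S \<noteq> {}" "S' \<noteq> {}" using xy by (auto simp: S_def S'_def)
    then have "card S > 0" "card S' > 0" using C(3,4) by (simp_all add: card_gt_0_iff)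
    then show "k \<ge> 1" "l \<ge> 1" by (simp_all add: k_def l_def)
  qed
  have D: "?D C C = ?D S S + ?D S S' + ?D S' S + ?D S' S'"
    unfolding C(1) using C(2-4) by (simp add: sum.union_disjoint sum.distrib)
  have SS: "?D S S = 0" by (simp add: S_def)
  have sym: "?D S' S = ?D S S'" by (subst sum.swap) (simp add: power2_commute)
  have "(\<Sum>x\<in>S. \<Sum>y\<in>S'. 1) \<le> ?D S S'"
    by (intro sum_mono int_square_ge_1) (auto simp: S_def S'_def)
  then have SS': "k * l \<le> ?D S S'" by (simp add: k_def l_def)
  have S'S': "0 \<le> ?D S' S'" by (simp add: sum_nonneg)
  have "0 \<le> (k - 1) * (l - 1)" using pos by simp
  then have kl1: "k + l - 1 \<le> k * l" by (simp add: algebra_simps)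
  have le': "0 + ?D S S' + ?D S S' + ?D S' S' \<le> 2 * (k + l - 1)"
    using le unfolding D SS sym kl[symmetric] .
  have arith: "A = x \<and> B = 0 \<and> x = y" if "0 + A + A + B \<le> 2 * y" "x \<le> A" "0 \<le> B" "y \<le> x" for A B x y :: int
    using that by linarith
  have eqs: "?D S S' = k * l" "?D S' S' = 0" "k * l = k + l - 1"
    using arith[OF le' SS' S'S' kl1] by blast+
  then show "?D C C = 2 * (int (card C) - 1)" unfolding D SS sym by (simp add: kl[symmetric])
  define x3 where "x3 = x2"
  have x3: "x3 \<in> S'" using xy by (simp add: S_def S'_def x3_def)
  have const: "b x = b x3" if "x \<in> S'" for x
  proof -
    have "\<forall>x\<in>S'. (\<Sum>y\<in>S'. (b x - b y)\<^sup>2) = 0"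
      using sum_nonneg_eq_0_iff[OF C(4), of "\<lambda>x. \<Sum>y\<in>S'. (b x - b y)\<^sup>2"] eqs(2) by (simp add: sum_nonneg)
    then have "(\<Sum>y\<in>S'. (b x - b y)\<^sup>2) = 0" using that by blast
    then have "(b x - b x3)\<^sup>2 = 0"
      using sum_nonneg_eq_0_iff[OF C(4), of "\<lambda>y. (b x - b y)\<^sup>2"] x3 by simp
    then show ?thesis by simp
  qed
  have "?D S S' = (\<Sum>x\<in>S. \<Sum>y\<in>S'. (b x1 - b x3)\<^sup>2)"
  proof (intro sum.cong refl)
    fix x y assume "x \<in> S" "y \<in> S'"
    then have "b x = b x1" "b y = b x3" using const by (simp add: S_def, blast)
    then show "(b x - b y)\<^sup>2 = (b x1 - b x3)\<^sup>2" by simp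
  qed
  then have "k * l * (b x1 - b x3)\<^sup>2 = k * l" using eqs(1) by (simp add: k_def l_def)
  then have "(b x1 - b x3)\<^sup>2 = 1" using pos by simp
  then have \<epsilon>: "b x1 - b x3 \<in> {1, -1}" "b x3 - b x1 \<in> {1, -1}" by (auto simp: power2_eq_1_iff)
  have "(k - 1) * (l - 1) = 0" using eqs(3) by (simp add: algebra_simps)
  then consider "card S = 1" | "card S' = 1" by (auto simp: k_def l_def)
  then show "\<exists>x0\<in>C. \<exists>\<epsilon>\<in>{1, -1}. \<exists>\<kappa>. \<forall>x\<in>C. b x = \<kappa> + (if x = x0 then \<epsilon> else 0)"
  proof cases
    case 1
    then obtain x0 where "S = {x0}" by (rule card_1_singletonE)
    moreover have "x1 \<in> S" using xy by (simp add: S_def)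
    ultimately have "S = {x1}" by simp
    then have "b x = b x3" if "x \<in> C" "x \<noteq> x1" for x using C(1) const that by blast
    then have "\<forall>x\<in>C. b x = b x3 + (if x = x1 then b x1 - b x3 else 0)" by simp
    then show ?thesis using \<epsilon> xy by blast
  next
    case 2
    then obtain x0 where "S' = {x0}" by (rule card_1_singletonE)
    then have "S' = {x3}" using x3 by simp
    then have "x \<in> S" if "x \<in> C" "x \<noteq> x3" for x using C(1) that by blast
    then have "b x = b x1" if "x \<in> C" "x \<noteq> x3" for x using that by (simp add: S_def)
    then have "\<forall>x\<in>C. b x = b x1 + (if x = x3 then b x3 - b x1 else 0)" by simp
    then show ?thesis using \<epsilon> x3 C by blast
  qed
qed

text \<open>
  Vanishes iff \<open>a\<close> depends only on the residue modulo \<open>q\<close>. Each pair of indices is counted twice.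
\<close>

definition defect :: "nat \<Rightarrow> nat \<Rightarrow> (nat \<Rightarrow> int) \<Rightarrow> int"
  where "defect p q a = (\<Sum>i<p*q. \<Sum>i' | i' < p*q \<and> i' mod q = i mod q. (a i - a i')\<^sup>2)"

lemma card_residue_class:
  assumes "c < (q::nat)"
  shows "card {i. i < p * q \<and> i mod q = c} = p"
proof -
  have "{i. i < p * q \<and> i mod q = c} = (\<lambda>t. c + t * q) ` {..<p}"
  proof (intro equalityI subsetI)
    fix i assume "i \<in> {i. i < p * q \<and> i mod q = c}"
    then show "i \<in> (\<lambda>t. c + t * q) ` {..<p}"
      by (intro image_eqI[of _ _ "i div q"]) (auto simp: less_mult_imp_div_less)
  next
    fix i assume "i \<in> (\<lambda>t. c + t * q) ` {..<p}"
    then obtain t where "t < p" "i = c + t * q" by auto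
    moreover have "c + t * q < Suc t * q" "Suc t * q \<le> p * q" 
      using assms \<open>t < p\<close> by (auto intro!: mult_le_mono1 simp del: mult_Suc) simp
    ultimately show "i \<in> {i. i < p * q \<and> i mod q = c}" using assms by auto
  qed
  moreover have "inj_on (\<lambda>t. c + t * q) {..<p}" using assms by (auto simp: inj_on_def)
  ultimately show ?thesis by (simp add: card_image)
qed

text \<open>
  A nonconstant residue class has \<open>p\<close> elements and already contributes the whole
  \<open>2 * (p - 1)\<close>. Hence there is only one, and it deviates from a constant at a single index, by 1.
\<close>

lemma defect_minimal:
  assumes p: "p \<ge> 2" and q: "q > 0" and d: "defect p q a = 2 * (int p - 1)"
  shows "\<exists>i0<p*q. \<exists>\<epsilon>\<in>{1, -1}. \<exists>\<kappa>. \<forall>i<p*q. a i = \<kappa> (i mod q) + (if i = i0 then \<epsilon> else 0)"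
proof -
  let ?cl = "\<lambda>i. {i'. i' < p * q \<and> i' mod q = i mod q}"
  let ?s = "\<lambda>i. \<Sum>i' \<in> ?cl i. (a i - a i')\<^sup>2"
  have "\<exists>i1<p*q. \<exists>i2\<in>?cl i1. a i1 \<noteq> a i2"
  proof (rule ccontr)
    assume "\<not> ?thesis"
    then have "a i = a i'" if "i < p * q" "i' \<in> ?cl i" for i i' using that by blast
    then have "?s i = 0" if "i < p * q" for i
      using that by (intro sum.neutral ballI) (metis diff_self zero_power2)
    then have "defect p q a = 0" by (simp add: defect_def)
    then show False using d p by simp
  qed
  then obtain i1 i2 where i: "i1 < p * q" "i2 \<in> ?cl i1" "a i1 \<noteq> a i2" by blast
  define C where "C = ?cl i1"
  have C: "finite C" "card C = p" "i1 \<in> C" "i2 \<in> C" "C \<subseteq> {..<p*q}"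
    using i q card_residue_class[of "i1 mod q" q p] by (auto simp: C_def)
  have "defect p q a = (\<Sum>i\<in>C. ?s i) + (\<Sum>i\<in>{..<p*q} - C. ?s i)"
    using C by (simp add: defect_def sum.subset_diff[of C "{..<p*q}"])
  moreover have "(\<Sum>i\<in>C. ?s i) = (\<Sum>i\<in>C. \<Sum>i'\<in>C. (a i - a i')\<^sup>2)"
    by (intro sum.cong) (auto simp: C_def)
  ultimately have d': "2 * (int p - 1) = (\<Sum>i\<in>C. \<Sum>i'\<in>C. (a i - a i')\<^sup>2) + (\<Sum>i\<in>{..<p*q} - C. ?s i)"
    using d by simp
  have nn: "0 \<le> ?s i" for i by (simp add: sum_nonneg)
  then have nn': "0 \<le> (\<Sum>i\<in>{..<p*q} - C. ?s i)" by (simp add: sum_nonneg)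
  have le: "(\<Sum>i\<in>C. \<Sum>i'\<in>C. (a i - a i')\<^sup>2) \<le> 2 * (int (card C) - 1)" using d' nn' C(2) by simp
  note min = sum_square_differences_minimal[OF C(1,3,4) i(3) le]
  then obtain i0 \<epsilon> k where i0: "i0 \<in> C" "\<epsilon> \<in> {1, -1}" "\<forall>x\<in>C. a x = k + (if x = i0 then \<epsilon> else 0)" by blast
  have "(\<Sum>i\<in>{..<p*q} - C. ?s i) = 0" using d' min(1) C(2) by simp
  then have "\<forall>i\<in>{..<p*q} - C. ?s i = 0" using nn by (subst (asm) sum_nonneg_eq_0_iff) auto
  have out: "a i = a i'" if "i < p * q" "i \<notin> C" "i' \<in> ?cl i" for i i'
  proof -
    have "?s i = 0" using \<open>\<forall>i\<in>{..<p*q} - C. ?s i = 0\<close> that by blast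
    then have "\<forall>i'\<in>?cl i. (a i - a i')\<^sup>2 = 0" by (subst (asm) sum_nonneg_eq_0_iff) simp_all
    then have "(a i - a i')\<^sup>2 = 0" using that(3) by blast
    then show ?thesis by simp
  qed
  define \<kappa> where "\<kappa> c = (if c = i1 mod q then k else a c)" for c
  have "a i = \<kappa> (i mod q) + (if i = i0 then \<epsilon> else 0)" if "i < p * q" for i
  proof (cases "i \<in> C")
    case True
    then have "a i = k + (if i = i0 then \<epsilon> else 0)" using i0(3) by blast
    moreover have "i mod q = i1 mod q" using True by (simp add: C_def)
    ultimately show ?thesis by (simp add: \<kappa>_def)
  next
    case False
    have "i mod q < p * q" using that mod_le_divisor le_less_trans mod_less_eq_dividend by blast
    then have "a i = a (i mod q)" using that False by (intro out) auto
    moreover have "i mod q \<noteq> i1 mod q" using False that by (auto simp: C_def)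
    ultimately show ?thesis using False i0 by (auto simp: \<kappa>_def)
  qed
  then show ?thesis using i0 C by blast
qed

lemma sum_residues:
  fixes f :: "nat \<Rightarrow> 'b::comm_ring_1"
  shows "(\<Sum>i<p*q. f (i mod q) * z ^ i) = (\<Sum>c<q. f c * z ^ c) * (\<Sum>t<p. (z ^ q) ^ t)"
proof -
  have "(\<Sum>i<p*q. f (i mod q) * z ^ i) = (\<Sum>t<p. \<Sum>i\<in>{t*q..<t*q+q}. f (i mod q) * z ^ i)"
    by (rule sum.nat_group[symmetric])
  also have "\<dots> = (\<Sum>t<p. \<Sum>c<q. f c * z ^ c * (z ^ q) ^ t)"
  proof (rule sum.cong[OF refl])
    fix t
    have "(\<Sum>i\<in>{t*q..<t*q+q}. f (i mod q) * z ^ i) = (\<Sum>c<q. f ((c + t * q) mod q) * z ^ (c + t * q))"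
      using sum.shift_bounds_nat_ivl[of "\<lambda>i. f (i mod q) * z ^ i" 0 "t * q" q]
      by (simp add: lessThan_atLeast0 add.commute)
    also have "\<dots> = (\<Sum>c<q. f c * z ^ c * (z ^ q) ^ t)"
      by (rule sum.cong) (auto simp: power_add mult_ac simp flip: power_mult)
    finally show "(\<Sum>i\<in>{t*q..<t*q+q}. f (i mod q) * z ^ i) = (\<Sum>c<q. f c * z ^ c * (z ^ q) ^ t)" .
  qed
  also have "\<dots> = (\<Sum>c<q. f c * z ^ c) * (\<Sum>t<p. (z ^ q) ^ t)"
    by (simp add: sum_product sum.swap[of _ "{..<p}"])
  finally show ?thesis .
qed

lemma sum_powers_root_of_unity:
  fixes z :: "'b::field"
  assumes "z ^ N = 1"
  shows "(\<Sum>j<N. z ^ j) = (if z = 1 then of_nat N else 0)"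
  using assms by (simp add: sum_gp_strict)

lemma sum_powers_nonmultiples:
  fixes z :: "'b::field"
  assumes z: "z ^ (p * q) = 1" and "p > 0"
  shows "(\<Sum>j | j < p * q \<and> \<not> p dvd j. z ^ j)
    = (if z = 1 then of_nat (p * q) else 0) - (if z ^ p = 1 then of_nat q else 0)"
proof -
  define J where "J = {j. j < p * q \<and> \<not> p dvd j}"
  have "{..<p * q} = J \<union> (\<lambda>k. p * k) ` {..<q}"
    using \<open>p > 0\<close> by (auto simp: J_def elim!: dvdE)
  moreover have "J \<inter> (\<lambda>k. p * k) ` {..<q} = {}" "finite J" by (auto simp: J_def)
  ultimately have "(\<Sum>j<p*q. z ^ j) = (\<Sum>j\<in>J. z ^ j) + (\<Sum>j\<in>(\<lambda>k. p * k) ` {..<q}. z ^ j)"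
    by (simp add: sum.union_disjoint)
  also have "(\<Sum>j\<in>(\<lambda>k. p * k) ` {..<q}. z ^ j) = (\<Sum>k<q. (z ^ p) ^ k)"
    using \<open>p > 0\<close> by (subst sum.reindex) (auto simp: inj_on_def power_mult)
  also have "\<dots> = (if z ^ p = 1 then of_nat q else 0)"
    using z by (intro sum_powers_root_of_unity) (simp add: power_mult)
  finally show ?thesis unfolding J_def sum_powers_root_of_unity[OF z] by simp
qed

lemma primitive_root_power_eq_iff:
  assumes "primitive_root_of_unity m \<theta>"
  shows "\<theta> ^ i = \<theta> ^ j \<longleftrightarrow> i mod m = j mod m"
proof -
  have m: "m > 0" "\<theta> ^ m = 1" and prim: "\<And>k. \<lbrakk>0 < k; k < m\<rbrakk> \<Longrightarrow> \<theta> ^ k \<noteq> 1"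
    using assms by (auto simp: primitive_root_of_unity_def)
  have "\<theta> \<noteq> 0" using m by (auto simp: power_0_left)
  have red: "\<theta> ^ k = \<theta> ^ (k mod m)" for k
    by (metis m(2) mult_div_mod_eq power_add power_mult power_one mult_1)
  have *: "i = j" if "i \<le> j" "j < m" "\<theta> ^ i = \<theta> ^ j" for i j
  proof (rule ccontr)
    assume "i \<noteq> j"
    have "\<theta> ^ i * \<theta> ^ (j - i) = \<theta> ^ i" using that by (metis le_add_diff_inverse power_add)
    then have "\<theta> ^ (j - i) = 1" using \<open>\<theta> \<noteq> 0\<close> by simp
    then show False using prim[of "j - i"] that \<open>i \<noteq> j\<close> by simp
  qed
  show ?thesis
    using *[of "i mod m" "j mod m"] *[of "j mod m" "i mod m"] m(1) red[of i] red[of j]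
    by (metis mod_less_divisor nat_le_linear)
qed

text \<open>
  A Parseval identity. Expanding the squared norms gives
  \<open>\<Sum>i i'. a i * a i' * (\<Sum>j. w i i' ^ j)\<close> with the root of unity \<open>w i i'\<close> equal to \<open>\<theta>\<close> to the power
  \<open>i - i'\<close>. The inner sum omits the multiples of \<open>p\<close>, so it is \<open>p * q\<close> when \<open>i = i'\<close> minus
  \<open>q\<close> when \<open>i\<close> and \<open>i'\<close> agree modulo \<open>q\<close>. Both sides thus equal \<open>2 * q * (p * P - Q)\<close>, with \<open>P\<close> the sum
  of the squares and \<open>Q\<close> the sum of the products over congruent pairs.
\<close>

lemma sum_norm_conjugates:
  fixes a :: "nat \<Rightarrow> int"
  assumes \<theta>: "primitive_root_of_unity (p * q) \<theta>"
  shows "2 * (\<Sum>j | j < p * q \<and> \<not> p dvd j. (cmod (\<Sum>i<p*q. of_int (a i) * (\<theta> ^ j) ^ i))\<^sup>2)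
    = real q * of_int (defect p q a)"
proof -
  let ?m = "p * q"
  define J where "J = {j. j < ?m \<and> \<not> p dvd j}"
  have m: "?m > 0" "\<theta> ^ ?m = 1" using \<theta> by (auto simp: primitive_root_of_unity_def)
  then have pq: "p > 0" "q > 0" by auto
  have "cmod \<theta> ^ ?m = 1" using arg_cong[OF m(2), of cmod] by (simp add: norm_power)
  then have "cmod \<theta> = 1" using power_eq_imp_eq_base[of "cmod \<theta>" ?m 1] m(1) by simp
  then have cn: "\<theta> * cnj \<theta> = 1" by (simp add: complex_norm_square[symmetric])
  define w where "w i i' = \<theta> ^ i * cnj \<theta> ^ i'" for i i'
  have w1: "w i i' ^ k = 1 \<longleftrightarrow> (i * k) mod ?m = (i' * k) mod ?m" for i i' k
  proof -
    have inv: "cnj \<theta> ^ i * \<theta> ^ i = 1" for i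
      using cn by (simp add: mult.commute flip: power_mult_distrib)
    have "w i i' ^ k = \<theta> ^ (i * k) * cnj \<theta> ^ (i' * k)"
      by (simp add: w_def power_mult_distrib power_mult)
    then have "w i i' ^ k * \<theta> ^ (i' * k) = \<theta> ^ (i * k)"
      using inv[of "i' * k"] by (simp add: mult.assoc)
    moreover have "\<theta> ^ (i' * k) \<noteq> 0" using inv[of "i' * k"] by (metis mult_zero_right zero_neq_one)
    ultimately have "w i i' ^ k = 1 \<longleftrightarrow> \<theta> ^ (i * k) = \<theta> ^ (i' * k)" by (metis mult_1 mult_cancel_right)
    then show ?thesis using primitive_root_power_eq_iff[OF \<theta>] by simp
  qed
  have wJ: "(\<Sum>j\<in>J. w i i' ^ j) = (if i = i' then of_nat ?m else 0) - (if i' mod q = i mod q then of_nat q else 0)"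
    if "i < ?m" "i' < ?m" for i i'
  proof -
    have "w i i' ^ ?m = 1" using w1[of i i' ?m] by simp
    note sum_powers_nonmultiples[OF this pq(1), folded J_def]
    also have "w i i' ^ p = 1 \<longleftrightarrow> i' mod q = i mod q"
      unfolding w1 using pq by (simp add: mult.commute[of _ p] flip: mult_mod_right) auto
    also have "w i i' = 1 \<longleftrightarrow> i = i'" using w1[of i i' 1] that by simp
    finally show ?thesis .
  qed
  define Q where "Q = (\<Sum>i<?m. \<Sum>i' | i' < ?m \<and> i' mod q = i mod q. a i * a i')"
  define P where "P = (\<Sum>i<?m. (a i)\<^sup>2)"
  have "of_real ((cmod (\<Sum>i<?m. of_int (a i) * (\<theta> ^ j) ^ i))\<^sup>2)
      = (\<Sum>i<?m. \<Sum>i'<?m. of_int (a i * a i') * w i i' ^ j)" for j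
  proof -
    have pw: "(x ^ j) ^ i = (x ^ i) ^ j" for x :: complex and i
      by (metis mult.commute power_mult)
    show ?thesis
      unfolding complex_norm_square
      by (simp add: sum_product w_def power_mult_distrib pw[of \<theta>] pw[of "cnj \<theta>"] mult_ac)
  qed
  then have "of_real (\<Sum>j\<in>J. (cmod (\<Sum>i<?m. of_int (a i) * (\<theta> ^ j) ^ i))\<^sup>2)
      = (\<Sum>j\<in>J. \<Sum>i<?m. \<Sum>i'<?m. of_int (a i * a i') * w i i' ^ j)" by simp
  also have "\<dots> = (\<Sum>i<?m. \<Sum>i'<?m. of_int (a i * a i') * (\<Sum>j\<in>J. w i i' ^ j))"
    by (simp add: sum.swap[of _ _ J] sum_distrib_left)
  also have "\<dots> = (\<Sum>i<?m. \<Sum>i'<?m. of_int (a i * a i' * ((if i = i' then int ?m else 0) - (if i' mod q = i mod q then int q else 0))))"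
    by (intro sum.cong refl) (simp add: wJ)
  also have "\<dots> = of_int (\<Sum>i<?m. \<Sum>i'<?m. (if i' = i then int ?m * (a i)\<^sup>2 else 0) - (if i' mod q = i mod q then int q * (a i * a i') else 0))"
    unfolding of_int_sum by (intro sum.cong refl arg_cong[of _ _ of_int]) (auto simp: power2_eq_square algebra_simps)
  also have "\<dots> = of_int (int ?m * P - int q * Q)"
    by (simp add: sum_subtractf P_def Q_def sum_distrib_left sum.inter_filter[symmetric] cong: conj_cong)
  finally have *: "of_real (\<Sum>j\<in>J. (cmod (\<Sum>i<?m. of_int (a i) * (\<theta> ^ j) ^ i))\<^sup>2) = (of_int (int ?m * P - int q * Q) :: complex)" .
  have norms: "(\<Sum>j\<in>J. (cmod (\<Sum>i<?m. of_int (a i) * (\<theta> ^ j) ^ i))\<^sup>2) = real_of_int (int ?m * P - int q * Q)"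
  proof -
    have "complex_of_real (\<Sum>j\<in>J. (cmod (\<Sum>i<?m. of_int (a i) * (\<theta> ^ j) ^ i))\<^sup>2)
        = complex_of_real (real_of_int (int ?m * P - int q * Q))"
      unfolding * by (simp only: of_real_of_int_eq)
    then show ?thesis by (simp only: of_real_eq_iff)
  qed
  have defect: "defect p q a = 2 * (int p * P - Q)"
  proof -
    have 1: "(\<Sum>i<?m. \<Sum>i' | i' < ?m \<and> i' mod q = i mod q. (a i)\<^sup>2) = int p * P"
      using pq by (simp add: card_residue_class P_def sum_distrib_left)
    have "(\<Sum>i<?m. \<Sum>i' | i' < ?m \<and> i' mod q = i mod q. (a i')\<^sup>2)
        = (\<Sum>i\<in>{..<?m}. \<Sum>i' | i' \<in> {..<?m} \<and> i' mod q = i mod q. (a i')\<^sup>2)" by simp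
    also have "\<dots> = (\<Sum>i'\<in>{..<?m}. \<Sum>i | i \<in> {..<?m} \<and> i' mod q = i mod q. (a i')\<^sup>2)"
      by (rule sum.swap_restrict) simp_all
    also have "\<dots> = (\<Sum>i'<?m. \<Sum>i | i < ?m \<and> i mod q = i' mod q. (a i')\<^sup>2)"
      by (intro sum.cong refl) auto
    finally have 2: "(\<Sum>i<?m. \<Sum>i' | i' < ?m \<and> i' mod q = i mod q. (a i')\<^sup>2) = int p * P"
      unfolding 1 .
    show ?thesis
      using 1 2 by (simp add: defect_def power2_diff sum_subtractf sum.distrib Q_def sum_distrib_left[symmetric] mult.assoc)
  qed
  show ?thesis unfolding J_def[symmetric] norms defect by (simp add: algebra_simps)
qed

text \<open>
  The sum carries the factor \<open>\<Sum>t<p. (z ^ q) ^ t\<close>, which vanishes. So in the cyclotomic ring coefficients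
  that depend only on the residue modulo \<open>q\<close> are invisible.
\<close>

lemma sum_residues_eq_0:
  fixes f :: "nat \<Rightarrow> 'b::field"
  assumes "z ^ (p * q) = 1" "z ^ q \<noteq> 1"
  shows "(\<Sum>i<p*q. f (i mod q) * z ^ i) = 0"
proof -
  have "(z ^ q) ^ p = 1" using assms(1) by (metis mult.commute power_mult)
  then have "(\<Sum>t<p. (z ^ q) ^ t) = 0" using assms(2) sum_powers_root_of_unity by fastforce
  then show ?thesis by (simp add: sum_residues)
qed

lemma primitive_root_conjugate:
  assumes \<theta>: "primitive_root_of_unity (p * q) \<theta>" and "\<not> p dvd j"
  shows "(\<theta> ^ j) ^ (p * q) = 1" "(\<theta> ^ j) ^ q \<noteq> 1"
proof -
  have pq: "p * q > 0" "\<theta> ^ (p * q) = 1" using \<theta> by (auto simp: primitive_root_of_unity_def)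
  show "(\<theta> ^ j) ^ (p * q) = 1" using pq(2) by (metis mult.commute power_mult power_one)
  show "(\<theta> ^ j) ^ q \<noteq> 1"
  proof
    assume "(\<theta> ^ j) ^ q = 1"
    then have "\<theta> ^ (j * q) = \<theta> ^ 0" by (simp add: power_mult)
    then have "p * q dvd j * q" unfolding primitive_root_power_eq_iff[OF \<theta>] by (simp add: dvd_eq_mod_eq_0)
    then show False using assms(2) pq(1) by simp
  qed
qed

text \<open>
  Kronecker's theorem for the cyclotomic ring, with control of the sign. If all conjugates have
  norm 1, the Parseval identity makes the defect of the coefficients minimal, so up to terms that
  evaluate to zero only one coefficient remains, and it is \<open>\<epsilon> = 1\<close> or \<open>\<epsilon> = -1\<close>. The discarded terms
  change the sum of the coefficients by a multiple of \<open>p\<close>, which ties \<open>\<epsilon>\<close> to that sum.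
\<close>

lemma kronecker_cyclotomic:
  fixes a :: "nat \<Rightarrow> int"
  assumes p: "p \<ge> 2" and \<theta>: "primitive_root_of_unity (p * q) \<theta>"
    and norm1: "\<And>j. \<lbrakk>j < p * q; \<not> p dvd j\<rbrakk> \<Longrightarrow> cmod (\<Sum>i<p*q. of_int (a i) * (\<theta> ^ j) ^ i) = 1"
  shows "\<exists>i0. \<exists>\<epsilon>\<in>{1, -1}. (\<Sum>i<p*q. of_int (a i) * \<theta> ^ i) = of_int \<epsilon> * \<theta> ^ i0
    \<and> int p dvd (\<Sum>i<p*q. a i) - \<epsilon>"
proof -
  have q: "q > 0" using \<theta> by (auto simp: primitive_root_of_unity_def)
  define J where "J = {j. j < p * q \<and> \<not> p dvd j}"
  have "(\<Sum>j\<in>J. (cmod (\<Sum>i<p*q. of_int (a i) * (\<theta> ^ j) ^ i))\<^sup>2) = (\<Sum>j\<in>J. 1 ^ j)"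
    using norm1 by (intro sum.cong) (auto simp: J_def)
  also have "\<dots> = real (p * q) - real q"
    unfolding J_def using p by (subst sum_powers_nonmultiples) simp_all
  finally have "real q * (2 * (real p - 1)) = real q * of_int (defect p q a)"
    unfolding sum_norm_conjugates[OF \<theta>, symmetric] J_def[symmetric] by (simp add: algebra_simps)
  then have "real_of_int (defect p q a) = real_of_int (2 * (int p - 1))" using q by simp
  then have "defect p q a = 2 * (int p - 1)" unfolding of_int_eq_iff .
  then obtain i0 \<epsilon> \<kappa> where i0: "i0 < p * q" and \<epsilon>: "\<epsilon> \<in> {1, -1}"
    and a: "\<And>i. i < p * q \<Longrightarrow> a i = \<kappa> (i mod q) + (if i = i0 then \<epsilon> else 0)"
    using defect_minimal[OF p q, of a] by blast
  have "(\<Sum>i<p*q. of_int (a i) * \<theta> ^ i)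
      = (\<Sum>i<p*q. of_int (\<kappa> (i mod q)) * \<theta> ^ i) + (\<Sum>i<p*q. if i = i0 then of_int \<epsilon> * \<theta> ^ i else 0)"
    unfolding sum.distrib[symmetric] by (intro sum.cong) (auto simp: a distrib_right)
  also have "(\<Sum>i<p*q. of_int (\<kappa> (i mod q)) * \<theta> ^ i) = 0"
    using primitive_root_conjugate[OF \<theta>, of 1] p by (intro sum_residues_eq_0) auto
  finally have 1: "(\<Sum>i<p*q. of_int (a i) * \<theta> ^ i) = of_int \<epsilon> * \<theta> ^ i0" using i0 by simp
  have "(\<Sum>i<p*q. a i) = (\<Sum>i<p*q. \<kappa> (i mod q)) + \<epsilon>"
    using i0 by (simp add: a sum.distrib)
  also have "(\<Sum>i<p*q. \<kappa> (i mod q)) = (\<Sum>c<q. \<kappa> c) * int p"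
    using sum_residues[of \<kappa> q 1 p] by simp
  finally show ?thesis using 1 \<epsilon> by auto
qed

text \<open>
  Only finitely many elements of the cyclotomic ring have all conjugates bounded by \<open>B\<close>: the
  Parseval identity bounds the defect, hence all differences \<open>a i - a (i mod q)\<close>, and these
  differences already determine the conjugates.
\<close>

lemma bounded_conjugates_finite:
  fixes B :: real
  assumes \<theta>: "primitive_root_of_unity (p * q) \<theta>"
  shows "\<exists>S. finite S \<and> (\<forall>a. (\<forall>j. j < p * q \<and> \<not> p dvd j \<longrightarrow>
        cmod (\<Sum>i<p*q. of_int (a i) * (\<theta> ^ j) ^ i) \<le> B) \<longrightarrow>
      (\<exists>s\<in>S. \<forall>j. j < p * q \<and> \<not> p dvd j \<longrightarrow>
        (\<Sum>i<p*q. of_int (a i) * (\<theta> ^ j) ^ i) = (\<Sum>i<p*q. of_int (s i) * (\<theta> ^ j) ^ i)))"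
proof -
  define J where "J = {j. j < p * q \<and> \<not> p dvd j}"
  have q: "q > 0" "p > 0" using \<theta> by (auto simp: primitive_root_of_unity_def)
  define R where "R = \<lceil>2 * (real (card J) * B\<^sup>2)\<rceil>"
  define S where "S = {s :: nat \<Rightarrow> int. \<forall>i. (i \<in> {..<p*q} \<longrightarrow> s i \<in> {-R..R}) \<and> (i \<notin> {..<p*q} \<longrightarrow> s i = 0)}"
  have "finite S" unfolding S_def by (rule finite_set_of_finite_funs) auto
  moreover have "\<exists>s\<in>S. \<forall>j. j < p * q \<and> \<not> p dvd j \<longrightarrow>
        (\<Sum>i<p*q. of_int (a i) * (\<theta> ^ j) ^ i) = (\<Sum>i<p*q. of_int (s i) * (\<theta> ^ j) ^ i)"
    if bd: "\<forall>j. j < p * q \<and> \<not> p dvd j \<longrightarrow> cmod (\<Sum>i<p*q. of_int (a i) * (\<theta> ^ j) ^ i) \<le> B" for a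
  proof -
    define s where "s i = (if i < p * q then a i - a (i mod q) else 0)" for i
    have "(\<Sum>j\<in>J. (cmod (\<Sum>i<p*q. of_int (a i) * (\<theta> ^ j) ^ i))\<^sup>2) \<le> (\<Sum>j\<in>J. B\<^sup>2)"
      using bd by (intro sum_mono power_mono) (auto simp: J_def)
    then have "real q * of_int (defect p q a) \<le> 2 * (real (card J) * B\<^sup>2)"
      unfolding sum_norm_conjugates[OF \<theta>, symmetric] J_def[symmetric] by simp
    moreover have nn: "0 \<le> defect p q a" by (simp add: defect_def sum_nonneg)
    then have "1 * real_of_int (defect p q a) \<le> real q * of_int (defect p q a)"
      using q by (intro mult_right_mono) auto
    ultimately have "real_of_int (defect p q a) \<le> 2 * (real (card J) * B\<^sup>2)" by linarith
    then have dR: "defect p q a \<le> R" unfolding R_def by linarith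
    have "s i \<in> {-R..R}" if i: "i < p * q" for i
    proof -
      have "i mod q < p * q" using i by (meson le_less_trans mod_less_eq_dividend)
      then have "(a i - a (i mod q))\<^sup>2 \<le> (\<Sum>i' | i' < p*q \<and> i' mod q = i mod q. (a i - a i')\<^sup>2)"
        by (intro member_le_sum) auto
      also have "\<dots> \<le> defect p q a"
        unfolding defect_def using i
        by (intro member_le_sum[of i "{..<p*q}" "\<lambda>i. \<Sum>i' | i' < p*q \<and> i' mod q = i mod q. (a i - a i')\<^sup>2"])
          (auto simp: sum_nonneg)
      finally have "(s i)\<^sup>2 \<le> R" using i dR by (simp add: s_def)
      moreover have "\<bar>s i\<bar> \<le> (s i)\<^sup>2"
        using int_square_ge_1[of "s i"] self_le_power[of "\<bar>s i\<bar>" 2] by (cases "s i = 0") auto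
      ultimately show ?thesis by auto
    qed
    then have "s \<in> S" by (simp add: S_def s_def)
    moreover have "(\<Sum>i<p*q. of_int (a i) * (\<theta> ^ j) ^ i) = (\<Sum>i<p*q. of_int (s i) * (\<theta> ^ j) ^ i)"
      if "\<not> p dvd j" for j
    proof -
      have "(\<Sum>i<p*q. of_int (a (i mod q)) * (\<theta> ^ j) ^ i) = 0"
        using primitive_root_conjugate[OF \<theta> that] by (intro sum_residues_eq_0)
      then show ?thesis by (simp add: s_def left_diff_distrib sum_subtractf)
    qed
    ultimately show ?thesis by blast
  qed
  ultimately show ?thesis by blast
qed

section \<open>Integral group rings of finite cyclic groups\<close>

lemma integral_group_ring_simps [simp]:
  "carrier (integral_group_ring G) = {a. Poly_Mapping.keys a \<subseteq> carrier G}"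
  "a \<oplus>\<^bsub>integral_group_ring G\<^esub> b = a + b"
  "\<zero>\<^bsub>integral_group_ring G\<^esub> = 0"
  "\<one>\<^bsub>integral_group_ring G\<^esub> = frag_of \<one>\<^bsub>G\<^esub>"
  by (simp_all add: integral_group_ring_def)

lemma int_adjoin_simps [simp]:
  "a \<oplus>\<^bsub>int_adjoin \<theta>\<^esub> b = a + b" "a \<otimes>\<^bsub>int_adjoin \<theta>\<^esub> b = a * b"
  "\<one>\<^bsub>int_adjoin \<theta>\<^esub> = 1" "\<zero>\<^bsub>int_adjoin \<theta>\<^esub> = 0"
  by (simp_all add: int_adjoin_def ring_of_type_algebra_def)

lemma comm_monoid_integral_group_ring:
  assumes "comm_group G"
  shows "comm_monoid (integral_group_ring G)"
proof -
  interpret G: comm_group G by fact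
  interpret R: ring "integral_group_ring G" by (rule ring_integral_group_ring[OF G.is_group])
  show ?thesis
  proof (rule R.monoid_comm_monoidI)
    fix a b assume "a \<in> carrier (integral_group_ring G)" "b \<in> carrier (integral_group_ring G)"
    then have ab: "Poly_Mapping.keys a \<subseteq> carrier G" "Poly_Mapping.keys b \<subseteq> carrier G" by simp_all
    have "a \<otimes>\<^bsub>integral_group_ring G\<^esub> b = (\<Sum>y\<in>Poly_Mapping.keys b. \<Sum>x\<in>Poly_Mapping.keys a.
        Poly_Mapping.single (x \<otimes>\<^bsub>G\<^esub> y) (Poly_Mapping.lookup a x * Poly_Mapping.lookup b y))"
      by (simp add: integral_group_ring_def) (rule sum.swap)
    also have "\<dots> = b \<otimes>\<^bsub>integral_group_ring G\<^esub> a"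
      using ab by (simp add: integral_group_ring_def) (intro sum.cong refl arg_cong2[of _ _ _ _ Poly_Mapping.single]; auto intro: G.m_comm)
    finally show "a \<otimes>\<^bsub>integral_group_ring G\<^esub> b = b \<otimes>\<^bsub>integral_group_ring G\<^esub> a" .
  qed
qed

locale integral_cyclic_group_ring = group G for G (structure) +
  fixes g :: 'a and m :: nat
  assumes generator: "g \<in> carrier G" "carrier G = generate G {g}"
    and order_m: "Coset.order G = m" "m > 0"
begin

abbreviation ZG where "ZG \<equiv> integral_group_ring G"

definition character :: "complex \<Rightarrow> ('a \<Rightarrow>\<^sub>0 int) \<Rightarrow> complex"
  where "character z a = (\<Sum>i<m. of_int (Poly_Mapping.lookup a (g [^] i)) * z ^ i)"

lemma ord_generator: "ord g = m"
  using generate_pow_card[OF generator(1)] generator(2) order_m by (simp add: Coset.order_def)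

lemma pow_eq_iff: "g [^] (i::nat) = g [^] (j::nat) \<longleftrightarrow> i mod m = j mod m"
  using int_pow_eq[OF generator(1), of "int i" "int j"] ord_generator
  by (simp add: int_pow_int) (metis mod_eq_dvd_iff of_nat_eq_iff zmod_int)

lemma bij_pow: "bij_betw (\<lambda>i. g [^] i) {..<m} (carrier G)"
proof (rule bij_betw_imageI)
  show "inj_on (\<lambda>i. g [^] i) {..<m}" by (auto simp: inj_on_def pow_eq_iff)
  show "(\<lambda>i. g [^] i) ` {..<m} = carrier G"
  proof
    show "carrier G \<subseteq> (\<lambda>i. g [^] i) ` {..<m}"
    proof
      fix x assume "x \<in> carrier G"
      then obtain k :: nat where "x = g [^] k"
        using generator generate_pow_nat[OF generator(1)] ord_generator order_m by auto
      then have "x = g [^] (k mod m)" using pow_eq_iff by simp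
      then show "x \<in> (\<lambda>i. g [^] i) ` {..<m}" using order_m by auto
    qed
  qed (use generator in auto)
qed

sublocale comm_group G
proof (rule group_comm_groupI)
  fix x y assume "x \<in> carrier G" "y \<in> carrier G"
  then obtain i j :: nat where "x = g [^] i" "y = g [^] j"
    using bij_pow unfolding bij_betw_def by blast
  then show "x \<otimes> y = y \<otimes> x" using generator by (simp add: nat_pow_mult add.commute)
qed

sublocale ZG: ring ZG by (rule ring_integral_group_ring[OF is_group])

sublocale ZG: comm_monoid ZG
  by (rule comm_monoid_integral_group_ring) unfold_locales

lemma character_diff: "character z (a - b) = character z a - character z b"
  by (simp add: character_def lookup_minus algebra_simps sum_subtractf)

lemma character_frag_of: "i < m \<Longrightarrow> character z (frag_of (g [^] i)) = z ^ i"
proof -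
  assume "i < m"
  have "character z (frag_of (g [^] i)) = (\<Sum>k<m. if k = i then z ^ k else 0)"
    unfolding character_def using \<open>i < m\<close>
    by (intro sum.cong) (auto simp: lookup_single when_def pow_eq_iff)
  then show ?thesis using \<open>i < m\<close> by simp
qed

text \<open>
  The polynomial evaluation \<open>character\<close> is what any such homomorphism computes. It makes the
  conjugates of \<open>\<pi>\<close> available on the same group ring, with values in a fixed field.
\<close>

lemma ring_hom_eq_character:
  assumes \<pi>: "\<pi> \<in> ring_hom ZG (int_adjoin \<zeta>)" "\<pi> (frag_of g) = z"
    and a: "a \<in> carrier ZG"
  shows "\<pi> a = character z a"
proof -
  interpret Z: ring "int_adjoin \<zeta>" by (rule ring_int_adjoin)
  have add: "\<pi> (x + y) = \<pi> x + \<pi> y" if "x \<in> carrier ZG" "y \<in> carrier ZG" for x y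
    using ring_hom_add[OF \<pi>(1), of x y] that by simp
  have pow: "\<pi> (frag_of (g [^] i)) = z ^ i" for i :: nat
  proof (induction i)
    case (Suc i)
    have "frag_of (g [^] Suc i) = frag_of (g [^] i) \<otimes>\<^bsub>ZG\<^esub> frag_of g"
      by (simp add: integral_group_ring_mult)
    then show ?case using ring_hom_mult[OF \<pi>(1), of "frag_of (g [^] i)" "frag_of g"] Suc generator(1) \<pi>(2)
      by (simp add: mult.commute)
  qed (use ring_hom_one[OF \<pi>(1)] in simp)
  have keys: "Poly_Mapping.keys a \<subseteq> carrier G" using a by simp
  have "a \<in> carrier ZG \<and> \<pi> a = character z a"
  proof (rule frag_induction[OF keys])
    show "0 \<in> carrier ZG \<and> \<pi> 0 = character z 0" using add[of 0 0] by (simp add: character_def)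
  next
    fix x assume "x \<in> carrier G"
    moreover from this obtain i where "i < m" "x = g [^] i" using bij_pow unfolding bij_betw_def by blast
    ultimately show "frag_of x \<in> carrier ZG \<and> \<pi> (frag_of x) = character z (frag_of x)"
      by (simp add: pow character_frag_of)
  next
    fix x y
    assume xy: "x \<in> carrier ZG \<and> \<pi> x = character z x" "y \<in> carrier ZG \<and> \<pi> y = character z y"
    then have "x - y \<in> carrier ZG" using keys_diff[of x y] by auto
    moreover from this have "\<pi> x = \<pi> (x - y) + \<pi> y" using add[of "x - y" y] xy by simp
    ultimately show "x - y \<in> carrier ZG \<and> \<pi> (x - y) = character z (x - y)"
      using xy by (simp add: character_diff)
  qed
  then show ?thesis ..
qed

text \<open>
  Only for \<open>z ^ m = 1\<close> does evaluation at \<open>z\<close> respect the relation \<open>g ^ m = 1\<close>; then it agrees with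
  a ring homomorphism.
\<close>

lemma character_mult:
  assumes "z ^ m = 1" "a \<in> carrier ZG" "b \<in> carrier ZG"
  shows "character z (a \<otimes>\<^bsub>ZG\<^esub> b) = character z a * character z b"
proof -
  obtain \<pi> where \<pi>: "\<pi> \<in> ring_hom ZG (int_adjoin z)" "\<pi> (frag_of g) = z"
    using ex_hom_integral_group_ring[OF is_group generator order_m assms(1)] by blast
  show ?thesis
    using ring_hom_mult[OF \<pi>(1) assms(2,3)] ring_hom_eq_character[OF \<pi> ZG.m_closed[OF assms(2,3)]]
      ring_hom_eq_character[OF \<pi> assms(2)] ring_hom_eq_character[OF \<pi> assms(3)] by simp
qed

lemma character_one: "character z \<one>\<^bsub>ZG\<^esub> = 1"
  using character_frag_of[of 0 z] order_m by simp

lemma character_unit_nonzero: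
  assumes "z ^ m = 1" "u \<in> Units ZG"
  shows "character z u \<noteq> 0"
proof -
  have "character z u * character z (inv\<^bsub>ZG\<^esub> u) = 1"
    using character_mult[OF assms(1), of u "inv\<^bsub>ZG\<^esub> u"] ZG.Units_closed ZG.Units_inv_closed
      ZG.Units_r_inv assms(2) character_one by metis
  then show ?thesis by auto
qed

lemma augmentation_eq_sum:
  assumes "a \<in> carrier ZG"
  shows "augmentation a = (\<Sum>i<m. Poly_Mapping.lookup a (g [^] i))"
proof -
  have "finite (carrier G)" using bij_pow bij_betw_finite by blast
  then have "augmentation a = (\<Sum>x\<in>carrier G. Poly_Mapping.lookup a x)"
    unfolding augmentation_def using assms
    by (intro sum.mono_neutral_left) (auto simp: in_keys_iff)
  also have "\<dots> = (\<Sum>i<m. Poly_Mapping.lookup a (g [^] i))"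
    by (rule sum.reindex_bij_betw[OF bij_pow, symmetric])
  finally show ?thesis .
qed

lemma augmentation_eq_character: "a \<in> carrier ZG \<Longrightarrow> of_int (augmentation a) = character 1 a"
  by (simp add: augmentation_eq_sum character_def)

abbreviation U where "U \<equiv> normalized_units G"

lemma normalized_units_simps [simp]:
  "carrier U = {u \<in> Units ZG. augmentation u = 1}"
  "u \<otimes>\<^bsub>U\<^esub> v = u \<otimes>\<^bsub>ZG\<^esub> v" "\<one>\<^bsub>U\<^esub> = \<one>\<^bsub>ZG\<^esub>"
  by (simp_all add: normalized_units_def units_of_def)

lemma augmentation_mult:
  assumes "a \<in> carrier ZG" "b \<in> carrier ZG"
  shows "augmentation (a \<otimes>\<^bsub>ZG\<^esub> b) = augmentation a * augmentation b"
proof -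
  have "complex_of_int (augmentation (a \<otimes>\<^bsub>ZG\<^esub> b)) = of_int (augmentation a * augmentation b)"
    using character_mult[of 1 a b] assms ZG.m_closed[OF assms]
    by (simp only: augmentation_eq_character of_int_mult power_one)
  then show ?thesis unfolding of_int_eq_iff .
qed

lemma frag_of_normalized_unit:
  assumes "x \<in> carrier G"
  shows "frag_of x \<in> carrier U"
proof -
  have "frag_of x \<otimes>\<^bsub>ZG\<^esub> frag_of (inv x) = \<one>\<^bsub>ZG\<^esub>" "frag_of (inv x) \<otimes>\<^bsub>ZG\<^esub> frag_of x = \<one>\<^bsub>ZG\<^esub>"
    using assms by (simp_all add: integral_group_ring_mult)
  then have "frag_of x \<in> Units ZG" unfolding Units_def using assms
    by (intro CollectI conjI bexI[of _ "frag_of (inv x)"]) simp_all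
  then show ?thesis by (simp add: augmentation_def)
qed

lemma comm_group_normalized_units: "comm_group U"
proof -
  interpret V: comm_group "units_of ZG" by (rule ZG.units_comm_group)
  have "subgroup {u \<in> Units ZG. augmentation u = 1} (units_of ZG)"
  proof
    fix u v assume uv: "u \<in> {u \<in> Units ZG. augmentation u = 1}" "v \<in> {u \<in> Units ZG. augmentation u = 1}"
    then have "u \<otimes>\<^bsub>ZG\<^esub> v \<in> Units ZG" by (intro ZG.Units_m_closed) auto
    moreover have "augmentation (u \<otimes>\<^bsub>ZG\<^esub> v) = 1"
      using uv augmentation_mult[of u v] ZG.Units_closed by auto
    ultimately show "u \<otimes>\<^bsub>units_of ZG\<^esub> v \<in> {u \<in> Units ZG. augmentation u = 1}"
      by (simp add: units_of_mult)
  next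
    show "\<one>\<^bsub>units_of ZG\<^esub> \<in> {u \<in> Units ZG. augmentation u = 1}"
      using frag_of_normalized_unit[of \<one>] by (simp add: units_of_one)
  next
    fix u assume u: "u \<in> {u \<in> Units ZG. augmentation u = 1}"
    then have "augmentation (u \<otimes>\<^bsub>ZG\<^esub> inv\<^bsub>ZG\<^esub> u) = augmentation u * augmentation (inv\<^bsub>ZG\<^esub> u)"
      by (intro augmentation_mult ZG.Units_closed ZG.Units_inv_Units) auto
    then have "augmentation (inv\<^bsub>ZG\<^esub> u) = 1"
      using u frag_of_normalized_unit[of \<one>] by (simp add: ZG.Units_r_inv)
    then show "inv\<^bsub>units_of ZG\<^esub> u \<in> {u \<in> Units ZG. augmentation u = 1}"
      using u by (simp add: ZG.units_of_inv)
  qed (auto simp: units_of_carrier)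
  then interpret U: group U
    unfolding normalized_units_def using subgroup.subgroup_is_group V.is_group by blast
  show ?thesis
    by (rule U.group_comm_groupI) (auto intro!: ZG.m_comm dest: ZG.Units_closed)
qed

lemma ring_hom_normalized_units:
  assumes \<pi>: "\<pi> \<in> ring_hom ZG S" and "monoid S"
  shows "\<pi> \<in> hom U (units_of S)"
proof (rule homI)
  interpret S: monoid S by fact
  fix u assume "u \<in> carrier U"
  then have u: "u \<in> Units ZG" "u \<in> carrier ZG" "inv\<^bsub>ZG\<^esub> u \<in> carrier ZG"
    using ZG.Units_closed ZG.Units_inv_closed by auto
  then have "\<pi> u \<otimes>\<^bsub>S\<^esub> \<pi> (inv\<^bsub>ZG\<^esub> u) = \<one>\<^bsub>S\<^esub>" "\<pi> (inv\<^bsub>ZG\<^esub> u) \<otimes>\<^bsub>S\<^esub> \<pi> u = \<one>\<^bsub>S\<^esub>"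
    using ring_hom_mult[OF \<pi>] ring_hom_one[OF \<pi>] ZG.Units_r_inv ZG.Units_l_inv by metis+
  then show "\<pi> u \<in> carrier (units_of S)"
    using ring_hom_closed[OF \<pi>] u by (auto simp: units_of_carrier Units_def)
next
  fix u v assume "u \<in> carrier U" "v \<in> carrier U"
  then show "\<pi> (u \<otimes>\<^bsub>U\<^esub> v) = \<pi> u \<otimes>\<^bsub>units_of S\<^esub> \<pi> v"
    using ring_hom_mult[OF \<pi>] ZG.Units_closed by (simp add: units_of_mult)
qed

end


section \<open>Units in the prime power case\<close>

text \<open>
  The order is written as \<open>p * p ^ k\<close>, so that the residues modulo \<open>q = p ^ k\<close>, which govern
  the relations among the powers of \<open>\<theta>\<close>, are available without subtraction.
\<close>

locale prime_power_cyclic_group_ring = integral_cyclic_group_ring G g "p * p ^ k" for G (structure) and g p k +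
  fixes \<theta> :: complex
  assumes prime_p: "Factorial_Ring.prime p" and primitive: "primitive_root_of_unity (p * p ^ k) \<theta>"
begin

abbreviation "J \<equiv> {j. j < p * p ^ k \<and> \<not> p dvd j}"

lemma conjugate_root: "\<not> p dvd j \<Longrightarrow> (\<theta> ^ j) ^ (p * p ^ k) = 1"
  using primitive_root_conjugate[OF primitive] by blast

text \<open>
  An integer polynomial vanishing at \<open>\<theta>\<close> vanishes at all primitive roots of the same order. On the
  units, the kernel of one faithful character thus lies in the kernels of its conjugates.
\<close>

lemma character_conjugate_trivial:
  assumes a: "character \<theta> a = 1" and j: "\<not> p dvd j"
  shows "character (\<theta> ^ j) a = 1"
proof -
  define f where "f = (\<Sum>i<p * p ^ k. monom (Poly_Mapping.lookup a (g [^] i)) i) - 1"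
  have ev: "poly (map_poly of_int f) z = character z a - 1" for z :: complex
  proof -
    have "map_poly of_int f = (\<Sum>i<p * p ^ k. monom (complex_of_int (Poly_Mapping.lookup a (g [^] i))) i) - 1"
      by (rule poly_eqI) (simp add: f_def coeff_map_poly coeff_sum of_int_sum if_distrib[of of_int] cong: if_cong)
    then show ?thesis by (simp add: character_def poly_sum poly_monom)
  qed
  have sum: "(\<Sum>t<p. (\<theta> ^ i) ^ (t * p ^ k)) = 0" if i: "\<not> p dvd i" for i
  proof -
    have "((\<theta> ^ i) ^ p ^ k) ^ p = 1" using conjugate_root[OF i] by (metis mult.commute power_mult)
    then have "(\<Sum>t<p. ((\<theta> ^ i) ^ p ^ k) ^ t) = 0"
      using primitive_root_conjugate(2)[OF primitive i] sum_powers_root_of_unity by fastforce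
    moreover have "(\<theta> ^ i) ^ (t * p ^ k) = ((\<theta> ^ i) ^ p ^ k) ^ t" for t
      by (metis mult.commute power_mult)
    ultimately show ?thesis by simp
  qed
  have "\<not> p dvd 1" using prime_p by auto
  then have "poly (map_poly of_int f) (\<theta> ^ j) = 0"
    using cyclotomic_conjugate[OF prime_p, of \<theta> k "\<theta> ^ j" f] sum[of 1] sum[OF j] ev[of \<theta>] a by simp
  then show ?thesis using ev by simp
qed

text \<open>
  Kronecker's theorem leaves a root of unity up to sign. The augmentation 1 decides the sign: \<open>\<epsilon> = -1\<close>
  requires \<open>p\<close> to divide 2, and for \<open>p = 2\<close> the number \<open>-1\<close> is itself a power of \<open>\<theta>\<close>.
\<close>

lemma unimodular_imp_power:
  assumes u: "u \<in> carrier U" and norm1: "\<And>j. j \<in> J \<Longrightarrow> cmod (character (\<theta> ^ j) u) = 1"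
  shows "\<exists>i. character \<theta> u = \<theta> ^ i"
proof -
  have p: "p \<ge> 2" using prime_p by (rule prime_ge_2_nat)
  obtain i \<epsilon> where \<epsilon>: "\<epsilon> \<in> {1, -1}" "character \<theta> u = of_int \<epsilon> * \<theta> ^ i"
      "int p dvd (\<Sum>i<p * p ^ k. Poly_Mapping.lookup u (g [^] i)) - \<epsilon>"
    using kronecker_cyclotomic[OF p primitive, of "\<lambda>i. Poly_Mapping.lookup u (g [^] i)"] norm1
    unfolding character_def by blast
  have "int p dvd 1 - \<epsilon>"
    using \<epsilon>(3) u augmentation_eq_sum[of u] ZG.Units_closed[of u] by simp
  show ?thesis
  proof (cases "\<epsilon> = 1")
    case False
    then have "\<epsilon> = -1" using \<epsilon> by simp
    then have "int p dvd 2" using \<open>int p dvd 1 - \<epsilon>\<close> by simp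
    then have "p = 2" using p by (auto dest: zdvd_imp_le)
    define q where "q = p ^ k"
    have "(\<theta> ^ q)\<^sup>2 = 1" 
      using conjugate_root[of 1] \<open>p = 2\<close> by (simp add: q_def mult.commute flip: power_mult)
    moreover have "\<theta> ^ q \<noteq> 1" using primitive_root_conjugate(2)[OF primitive, of 1] \<open>p = 2\<close> by (simp add: q_def)
    ultimately have "\<theta> ^ q = -1" by (simp add: power2_eq_1_iff)
    then have "character \<theta> u = \<theta> ^ (q + i)" using \<epsilon>(2) \<open>\<epsilon> = -1\<close> by (simp add: power_add)
    then show ?thesis by blast
  qed (use \<epsilon> in auto)
qed

lemma ex_inverse_power: "\<exists>k'. \<theta> ^ i * \<theta> ^ k' = 1"
proof -
  let ?m = "p * p ^ k"
  have root: "\<theta> ^ ?m = 1" using primitive by (simp add: primitive_root_of_unity_def)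
  have "i + i * (?m - 1) = ?m * i" using order_m(2) by (cases ?m) simp_all
  then have "\<theta> ^ i * \<theta> ^ (i * (?m - 1)) = (\<theta> ^ ?m) ^ i" by (metis power_add power_mult)
  then show ?thesis unfolding root by auto
qed

text \<open>
  The torsion of the image lifts: a unit \<open>u\<close> whose image is a power of \<open>\<theta>\<close> is moved into the kernel
  by a unique power of \<open>g\<close>. Uniqueness makes \<open>f\<close> multiplicative and the identity on the kernel.
\<close>

lemma ex_retraction_on_unimodular:
  defines "N \<equiv> {u \<in> carrier U. character \<theta> u = 1}"
    and "K \<equiv> {u \<in> carrier U. \<exists>i. character \<theta> u = \<theta> ^ i}"
  shows "\<exists>f. (\<forall>u\<in>K. f u \<in> N) \<and> (\<forall>u\<in>K. \<forall>v\<in>K. f (u \<otimes>\<^bsub>U\<^esub> v) = f u \<otimes>\<^bsub>U\<^esub> f v) \<and> (\<forall>u\<in>N. f u = u)"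
proof -
  interpret U: comm_group U by (rule comm_group_normalized_units)
  have root: "\<theta> ^ (p * p ^ k) = 1" using primitive by (simp add: primitive_root_of_unity_def)
  have \<chi>_mult: "character \<theta> (u \<otimes>\<^bsub>U\<^esub> v) = character \<theta> u * character \<theta> v" if "u \<in> carrier U" "v \<in> carrier U" for u v
    using that character_mult[OF root, of u v] ZG.Units_closed by simp
  have \<chi>_pow: "character \<theta> (frag_of (g [^] i)) = \<theta> ^ i" for i :: nat
  proof -
    have "g [^] i = g [^] (i mod (p * p ^ k))" "\<theta> ^ i = \<theta> ^ (i mod (p * p ^ k))"
      using pow_eq_iff[of i "i mod (p * p ^ k)"] primitive_root_power_eq_iff[OF primitive] by simp_all
    then show ?thesis using character_frag_of[of "i mod (p * p ^ k)" \<theta>] order_m(2) by simp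
  qed
  have gU: "frag_of (g [^] i) \<in> carrier U" for i :: nat
    by (intro frag_of_normalized_unit nat_pow_closed generator(1))
  have g_add: "frag_of (g [^] (i + j)) = frag_of (g [^] i) \<otimes>\<^bsub>U\<^esub> frag_of (g [^] j)" for i j :: nat
    using generator by (simp add: integral_group_ring_mult nat_pow_mult)
  have g_eq: "frag_of (g [^] i) = frag_of (g [^] j)" if "\<theta> ^ i = \<theta> ^ j" for i j :: nat
    
  proof -
    have "g [^] i = g [^] j" using that unfolding pow_eq_iff primitive_root_power_eq_iff[OF primitive] .
    then show ?thesis by simp
  qed
  define e where "e u = (SOME k'. character \<theta> u * \<theta> ^ k' = 1)" for u
  have e: "character \<theta> u * \<theta> ^ e u = 1" if "u \<in> K" for u
  proof -
    have "\<exists>k'. character \<theta> u * \<theta> ^ k' = 1" using that ex_inverse_power by (auto simp: K_def)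
    then show ?thesis unfolding e_def by (rule someI_ex)
  qed
  define f where "f u = u \<otimes>\<^bsub>U\<^esub> frag_of (g [^] e u)" for u
  have KU: "u \<in> carrier U" if "u \<in> K" for u using that by (simp add: K_def)
  have "f u \<in> N" if "u \<in> K" for u
    using U.m_closed[OF KU[OF that] gU] \<chi>_mult[OF KU[OF that] gU] e[OF that] \<chi>_pow
    unfolding N_def f_def by simp
  moreover have "f (u \<otimes>\<^bsub>U\<^esub> v) = f u \<otimes>\<^bsub>U\<^esub> f v" if "u \<in> K" "v \<in> K" for u v
  proof -
    have uv: "u \<in> carrier U" "v \<in> carrier U" using that KU by auto
    have "u \<otimes>\<^bsub>U\<^esub> v \<in> K" using that \<chi>_mult[OF uv] U.m_closed[OF uv] unfolding K_def 
      by (auto simp del: normalized_units_simps simp flip: power_add)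
    from e[OF this] have "character \<theta> u * character \<theta> v * \<theta> ^ e (u \<otimes>\<^bsub>U\<^esub> v) = 1" using \<chi>_mult[OF uv] by simp
    moreover have "character \<theta> u * character \<theta> v * \<theta> ^ (e u + e v) = 1"
      using e[OF that(1)] e[OF that(2)] by (simp add: power_add mult_ac) (metis mult.assoc mult.left_commute mult_1)
    ultimately have "\<theta> ^ e (u \<otimes>\<^bsub>U\<^esub> v) = \<theta> ^ (e u + e v)"
      by (metis mult_cancel_left mult_zero_left zero_neq_one)
    then show ?thesis
      unfolding f_def using g_eq[of "e (u \<otimes>\<^bsub>U\<^esub> v)" "e u + e v"] uv gU
      by (simp only: g_add U.m_ac U.m_closed)
  qed
  moreover have "f u = u" if "u \<in> N" for u
  proof -
    have "u \<in> K" using that unfolding K_def N_def by (auto intro: exI[of _ 0])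
    then have "\<theta> ^ e u = \<theta> ^ 0" using e[of u] that by (simp add: N_def)
    then have "frag_of (g [^] e u) = \<one>\<^bsub>U\<^esub>" using g_eq[of "e u" 0] by simp
    then show ?thesis unfolding f_def using U.r_one KU[OF \<open>u \<in> K\<close>] by simp
  qed
  ultimately show ?thesis by blast
qed

text \<open>
  The logarithmic embedding \<open>u \<mapsto> (ln \<bar>\<chi> j u\<bar>)\<close>, with \<open>\<chi> j\<close> evaluation at \<open>\<theta> ^ j\<close>, has discrete image.
  The retraction onto the kernel \<open>N\<close> of evaluation at \<open>\<theta>\<close> is known on the kernel of this
  embedding, which contains \<open>N\<close>, and extends from there to all normalized units.
\<close>

lemma ex_retraction:
  defines "N \<equiv> {u \<in> carrier U. character \<theta> u = 1}"
  shows "\<exists>\<rho> \<in> hom U (U\<lparr>carrier := N\<rparr>). \<forall>u\<in>N. \<rho> u = u"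
proof -
  interpret U: comm_group U by (rule comm_group_normalized_units)
  define l where "l j u = ln (cmod (character (\<theta> ^ j) u))" for j u
  define K where "K = {u \<in> carrier U. \<exists>i. character \<theta> u = \<theta> ^ i}"
  have nz: "character (\<theta> ^ j) u \<noteq> 0" if "j \<in> J" "u \<in> carrier U" for j u
    using that character_unit_nonzero[OF conjugate_root] by simp
  have add: "l j (u \<otimes>\<^bsub>U\<^esub> v) = l j u + l j v" if "j \<in> J" "u \<in> carrier U" "v \<in> carrier U" for j u v
  proof -
    have "character (\<theta> ^ j) (u \<otimes>\<^bsub>U\<^esub> v) = character (\<theta> ^ j) u * character (\<theta> ^ j) v"
      using that character_mult[OF conjugate_root, of j u v] ZG.Units_closed by simp
    then show ?thesis using nz that by (simp add: l_def norm_mult ln_mult_pos)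
  qed
  have disc: "\<exists>S. finite S \<and> (\<forall>u\<in>carrier U. (\<forall>j\<in>J. \<bar>l j u\<bar> \<le> M) \<longrightarrow> (\<exists>s\<in>S. \<forall>j\<in>J. l j u = l j s))" for M
  proof -
    let ?c = "\<lambda>u i. Poly_Mapping.lookup u (g [^] (i::nat))"
    let ?v = "\<lambda>a j. \<Sum>i<p * p ^ k. of_int (a i) * (\<theta> ^ j) ^ i"
    obtain S where "finite S" and S: "\<And>a. (\<forall>j. j < p * p ^ k \<and> \<not> p dvd j \<longrightarrow> cmod (?v a j) \<le> exp M)
        \<Longrightarrow> \<exists>s\<in>S. \<forall>j. j < p * p ^ k \<and> \<not> p dvd j \<longrightarrow> ?v a j = ?v s j"
      using bounded_conjugates_finite[OF primitive, of "exp M"] by blast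
    define L where "L s = restrict (\<lambda>j. ln (cmod (?v s j))) J" for s
    define r where "r u = restrict (\<lambda>j. l j u) J" for u
    define A where "A = {u \<in> carrier U. \<forall>j\<in>J. \<bar>l j u\<bar> \<le> M}"
    have "r ` A \<subseteq> L ` S"
    proof (rule image_subsetI)
      fix u assume u: "u \<in> A"
      have "cmod (?v (?c u) j) \<le> exp M" if "j \<in> J" for j
      proof -
        have "ln (cmod (character (\<theta> ^ j) u)) \<le> M" using u that by (auto simp: A_def l_def abs_le_iff)
        moreover have "cmod (character (\<theta> ^ j) u) > 0" using nz[OF that] u by (simp add: A_def)
        ultimately have "cmod (character (\<theta> ^ j) u) \<le> exp M" by (metis exp_le_cancel_iff exp_ln)
        then show ?thesis by (simp add: character_def)
      qed
      then obtain s where "s \<in> S" "\<forall>j\<in>J. ?v (?c u) j = ?v s j" using S[of "?c u"] by auto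
      then show "r u \<in> L ` S"
        by (intro image_eqI[of _ _ s]) (auto simp: r_def L_def l_def character_def fun_eq_iff restrict_def)
    qed
    then have fin: "finite (r ` A)" using \<open>finite S\<close> finite_subset by blast
    then obtain T where T: "finite T" "r ` A = r ` T"
      using finite_subset_image[OF fin subset_refl] by blast
    have "\<exists>s\<in>T. \<forall>j\<in>J. l j u = l j s" if "u \<in> A" for u
    proof -
      have "r u \<in> r ` T" using imageI[OF that, of r] unfolding T(2) .
      then obtain s where "s \<in> T" and s: "r u = r s" by (elim imageE)
      have "l j u = l j s" if "j \<in> J" for j using fun_cong[OF s, of j] that by (simp add: r_def)
      then show ?thesis using \<open>s \<in> T\<close> by blast
    qed
    then show ?thesis using T(1) unfolding A_def by blast
  qed
  have KN: "u \<in> K" if "u \<in> carrier U" "\<forall>j\<in>J. l j u = 0" for u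
  proof -
    have "cmod (character (\<theta> ^ j) u) = 1" if "j \<in> J" for j
    proof -
      have "ln (cmod (character (\<theta> ^ j) u)) = 0" using \<open>\<forall>j\<in>J. l j u = 0\<close> that unfolding l_def by blast
      then show ?thesis using nz[OF that \<open>u \<in> carrier U\<close>] by (subst (asm) ln_eq_zero_iff) simp_all
    qed
    from unimodular_imp_power[OF that(1) this] show ?thesis using that(1) by (simp add: K_def)
  qed
  obtain f where f: "\<And>u. u \<in> K \<Longrightarrow> f u \<in> N" "\<And>u v. \<lbrakk>u \<in> K; v \<in> K\<rbrakk> \<Longrightarrow> f (u \<otimes>\<^bsub>U\<^esub> v) = f u \<otimes>\<^bsub>U\<^esub> f v"
      "\<And>u. u \<in> N \<Longrightarrow> f u = u"
    using ex_retraction_on_unimodular[folded N_def K_def] by blast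
  note extend = U.extend_hom_from_discrete_kernel
    [where I = J and H = "U\<lparr>carrier := N\<rparr>" and l = l and f = f, OF _ add disc]
  have "\<exists>F \<in> hom U (U\<lparr>carrier := N\<rparr>). \<forall>u\<in>carrier U. (\<forall>j\<in>J. l j u = 0) \<longrightarrow> F u = f u"
  proof (rule extend)
    fix u assume "u \<in> carrier U" "\<forall>j\<in>J. l j u = 0"
    then show "f u \<in> carrier (U\<lparr>carrier := N\<rparr>)" using f(1)[OF KN] by simp
  next
    fix u v assume "u \<in> carrier U" "\<forall>j\<in>J. l j u = 0" "v \<in> carrier U" "\<forall>j\<in>J. l j v = 0"
    then show "f (u \<otimes>\<^bsub>U\<^esub> v) = f u \<otimes>\<^bsub>U\<lparr>carrier := N\<rparr>\<^esub> f v" using f(2)[OF KN KN] by simp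
  qed auto
  then obtain F where F: "F \<in> hom U (U\<lparr>carrier := N\<rparr>)"
      "\<And>u. \<lbrakk>u \<in> carrier U; \<forall>j\<in>J. l j u = 0\<rbrakk> \<Longrightarrow> F u = f u"
    by blast
  have "F u = u" if "u \<in> N" for u
  proof -
    have "\<forall>j\<in>J. l j u = 0" using that character_conjugate_trivial by (simp add: N_def l_def)
    then show ?thesis using F(2)[of u] f(3) that by (simp add: N_def)
  qed
  then show ?thesis using F(1) by blast
qed

end

theorem theorem7:
  fixes G :: "('a, 'm) monoid_scheme"
    and g :: 'a
    and p n :: nat
    and \<theta> :: complex
    and \<pi>\<^sub>1 :: "('a \<Rightarrow>\<^sub>0 int) \<Rightarrow> complex"
  assumes "Factorial_Ring.prime p" and "n \<ge> 1"
    and "group G" and "g \<in> carrier G" and "carrier G = generate G {g}" and "Coset.order G = p ^ n"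
    and "primitive_root_of_unity (p ^ n) \<theta>"
    and "\<pi>\<^sub>1 \<in> ring_hom (integral_group_ring G) (int_adjoin \<theta>)"
    and "\<pi>\<^sub>1 (frag_of g) = \<theta>"
  shows "normalized_units G \<cong>
    (normalized_units G)
      \<lparr>carrier := kernel (normalized_units G) (units_of (int_adjoin \<theta>)) \<pi>\<^sub>1\<rparr> \<times>\<times>
    (units_of (int_adjoin \<theta>))\<lparr>carrier := \<pi>\<^sub>1 ` carrier (normalized_units G)\<rparr>"
proof -
  have pn: "p ^ n = p * p ^ (n - 1)" using \<open>n \<ge> 1\<close> by (cases n) simp_all
  interpret group G by fact
  interpret prime_power_cyclic_group_ring G g p "n - 1" \<theta>
    by unfold_locales (use assms pn prime_gt_0_nat in auto)
  interpret Z: ring "int_adjoin \<theta>" by (rule ring_int_adjoin)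
  have \<pi>: "\<pi>\<^sub>1 u = character \<theta> u" if "u \<in> carrier U" for u
    using ring_hom_eq_character[OF assms(8,9)] ZG.Units_closed that by simp
  have ker: "kernel U (units_of (int_adjoin \<theta>)) \<pi>\<^sub>1 = {u \<in> carrier U. character \<theta> u = 1}"
    unfolding kernel_def using \<pi> by (auto simp: units_of_one)
  obtain \<rho> where \<rho>: "\<rho> \<in> hom U (U\<lparr>carrier := kernel U (units_of (int_adjoin \<theta>)) \<pi>\<^sub>1\<rparr>)"
      "\<And>u. u \<in> kernel U (units_of (int_adjoin \<theta>)) \<pi>\<^sub>1 \<Longrightarrow> \<rho> u = u"
    using ex_retraction unfolding ker by blast
  have "\<pi>\<^sub>1 \<in> hom U (units_of (int_adjoin \<theta>))"
    by (rule ring_hom_normalized_units[OF assms(8) Z.monoid_axioms])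
  from iso_kernel_times_image[OF comm_group_normalized_units Z.units_group this refl \<rho>]
  show ?thesis .
qed

end
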